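(* Let $n\ge2$ and $\mathbf a=(a_0,\dots,a_n)\in\mathbb Z^{n+1}$ with pairwise distinct entries, and $\Theta_{\mathbf a}=\eta^{-n(n-1)/2}\prod_{0\le i<j\le n}\vartheta_{a_i-a_j}$. Then $$\Theta_{\mathbf a}=\sum_{\substack{\mathbf x\in(\frac n2+\mathbb Z)^{n+1}\\ \mathbf x\cdot\mathbf 1=0}}\sigma(\mathbf x)\,q^{\mathbf x^2/2(n+1)}\,\zeta^{\mathbf a\cdot\mathbf x},$$ where $\sigma(\mathbf x)=\operatorname{sign}(\pi)$ if there is a permutation $\pi$ of $\{0,\dots,n\}$ such that $\mathbf x\equiv-\frac n2\mathbf 1+(\pi(0),\pi(1),\dots,\pi(n))\pmod{(n+1)\mathbb Z}$ (componentwise), and $\sigma(\mathbf x)=0$ otherwise.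
   Context: $\eta(\tau)=q^{1/24}\prod_{n\ge1}(1-q^n)$, $\vartheta(\tau,z)=\sum_{r\in\mathbb Z}\left(\frac{-4}{r}\right)q^{r^2/8}\zeta^{r/2}$, $q=e^{2\pi i\tau}$, $\zeta=e^{2\pi iz}$, $\vartheta_a(\tau,z)=\vartheta(\tau,az)$. $\mathbf 1=(1,\dots,1)$, $\mathbf x\cdot\mathbf y$ is the standard scalar product and $\mathbf x^2=\mathbf x\cdot\mathbf x$.
   Formalization: The formal identity has the extra factor (-1)^{n(n+1)/2} in front of the sum over x; without it the two sides differ by a sign when n ≡ 1, 2 (mod 4), e.g. n=2, a=(2,1,0), where the q^{1/3}ζ^2 coefficients are +1 and -1. *)

theory Defs
  imports "HOL-Analysis.Analysis" "HOL-Combinatorics.Combinatorics"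
begin

text \<open>
  \<open>cpow w s\<close> is the fractional power written \<open>q\<^sup>s\<close> for \<open>w = \<tau>\<close> and \<open>\<zeta>\<^sup>s\<close> for \<open>w = z\<close>, where
  \<open>q = exp (2 \<pi> \<i> \<tau>)\<close> and \<open>\<zeta> = exp (2 \<pi> \<i> z)\<close>. It is a function of \<open>w\<close>, so no branch of a
  logarithm is involved.
\<close>
definition cpow :: "complex \<Rightarrow> real \<Rightarrow> complex" where
  "cpow w s = exp (2 * of_real pi * \<i> * of_real s * w)"

definition dedekind_eta :: "complex \<Rightarrow> complex" where
  "dedekind_eta \<tau> = cpow \<tau> (1/24) * (\<Prod>m. 1 - cpow \<tau> 1 ^ Suc m)"

text \<open>The Kronecker symbol $(-4/r)$, i.e. the nontrivial Dirichlet character modulo 4.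
  In particular $(-4/{-1}) = -1$.\<close>
definition kronecker_m4 :: "int \<Rightarrow> int" where
  "kronecker_m4 r = (if r mod 4 = 1 then 1 else if r mod 4 = 3 then -1 else 0)"

definition jacobi_theta :: "complex \<Rightarrow> complex \<Rightarrow> complex" where
  "jacobi_theta \<tau> z =
     (\<Sum>\<^sub>\<infinity>r\<in>UNIV. of_int (kronecker_m4 r) * cpow \<tau> (of_int r ^ 2 / 8) * cpow z (of_int r / 2))"

definition jacobi_theta_scaled :: "int \<Rightarrow> complex \<Rightarrow> complex \<Rightarrow> complex" where
  "jacobi_theta_scaled a \<tau> z = jacobi_theta \<tau> (of_int a * z)"

text \<open>
  Vectors of length \<open>n + 1\<close> are functions on \<open>nat\<close> of which only the values on \<open>{0..n}\<close> matter.
  The natural number division by 2 in the exponent is exact.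
\<close>
definition theta_block :: "nat \<Rightarrow> (nat \<Rightarrow> int) \<Rightarrow> complex \<Rightarrow> complex \<Rightarrow> complex" where
  "theta_block n a \<tau> z =
     dedekind_eta \<tau> powi (- int (n * (n - 1) div 2)) *
     (\<Prod>(i, j) \<in> {(i, j). i < j \<and> j \<le> n}. jacobi_theta_scaled (a i - a j) \<tau> z)"

text \<open>The index set: vectors in \<open>(n/2 + \<int>)\<^bsup>n+1\<^esup>\<close> with coordinate sum 0. Extensionality makes
  each vector occur exactly once.\<close>
definition index_vectors :: "nat \<Rightarrow> (nat \<Rightarrow> real) set" where
  "index_vectors n =
     {x \<in> {0..n} \<rightarrow>\<^sub>E range (\<lambda>k::int. real n / 2 + of_int k). (\<Sum>i=0..n. x i) = 0}"

definition perm_congruent :: "nat \<Rightarrow> (nat \<Rightarrow> real) \<Rightarrow> (nat \<Rightarrow> nat) \<Rightarrow> bool" where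
  "perm_congruent n x p \<longleftrightarrow> p permutes {0..n} \<and>
     (\<forall>i\<le>n. \<exists>k::int. x i = - real n / 2 + real (p i) + of_int k * real (n + 1))"

lemma perm_congruent_unique:
  assumes "perm_congruent n x p" "perm_congruent n x p'"
  shows "p = p'"
proof
  fix i
  show "p i = p' i"
  proof (cases "i \<le> n")
    case True
    obtain k k' :: int where
      "x i = - real n / 2 + real (p i) + of_int k * real (n + 1)"
      "x i = - real n / 2 + real (p' i) + of_int k' * real (n + 1)"
      using assms True unfolding perm_congruent_def by blast
    then have "real_of_int (int (p i) + k * int (n + 1)) = real_of_int (int (p' i) + k' * int (n + 1))"
      by simp
    then have "int (p i) + k * int (n + 1) = int (p' i) + k' * int (n + 1)"
      by (simp only: of_int_eq_iff)
    then have "int (p i) mod int (n + 1) = int (p' i) mod int (n + 1)"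
      by (metis mod_mult_self1)
    moreover have "p i \<le> n" "p' i \<le> n"
      using assms True permutes_in_image[of _ "{0..n}" i] unfolding perm_congruent_def by auto
    ultimately show ?thesis by simp
  next
    case False
    then show ?thesis
      using assms unfolding perm_congruent_def by (metis atLeastAtMost_iff permutes_not_in)
  qed
qed

text \<open>
  The permutation is unique by \<open>perm_congruent_unique\<close>. Note the normalisation: the identity
  belongs to \<open>x = (-n/2, \<dots>, n/2)\<close>, so \<open>vector_sign\<close> is 1 there, whereas the coefficient of
  \<open>\<zeta>\<^bsup>a\<cdot>x\<^esup>\<close> in the leading term of \<open>theta_block\<close> is \<open>(-1)\<^bsup>n(n+1)/2\<^esup>\<close>, each of the
  \<open>n(n+1)/2\<close> theta factors contributing \<open>-\<zeta>\<^bsup>-(a\<^sub>i - a\<^sub>j)/2\<^esup>\<close>.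
\<close>
definition vector_sign :: "nat \<Rightarrow> (nat \<Rightarrow> real) \<Rightarrow> int" where
  "vector_sign n x =
     (if \<exists>p. perm_congruent n x p then sign (THE p. perm_congruent n x p) else 0)"

definition theta_block_term :: "nat \<Rightarrow> (nat \<Rightarrow> int) \<Rightarrow> complex \<Rightarrow> complex \<Rightarrow> (nat \<Rightarrow> real) \<Rightarrow> complex" where
  "theta_block_term n a \<tau> z x =
     of_int (vector_sign n x) * cpow \<tau> ((\<Sum>i=0..n. x i ^ 2) / (2 * real (n + 1))) *
     cpow z (\<Sum>i=0..n. of_int (a i) * x i)"

end

theory Submission
  imports Defs "HOL-Library.Nat_Bijection" "HOL-Computational_Algebra.Polynomial"
begin

text \<open>
  Put $N = n + 1$ and let $u_0, \dots, u_n$ be arbitrary complex numbers. Expanding every theta factor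
  of $P(u) = \prod_{i<j} \vartheta(u_i - u_j)$ gives a sum over skew-symmetric matrices $r$ with odd
  entries; collecting the matrices with $x_i = \frac12 \sum_j r_{ij}$ gives
  $P(u) = \sum_x c_x \prod_i e(u_i x_i)$. Permuting the indices of $r$ shows that $c$ is alternating,
  and replacing $r_{ij}$ by $r_{ij} + 2 (k_i - k_j)$ with $\sum_i k_i = 0$ shows that
  $c_x q^{-x^2/2N}$ depends only on $x$ modulo $N$ times the root lattice. Hence
  $c_x = C(\tau) \sigma(x) q^{x^2/2N}$: if two coordinates of $x$ agree modulo $N$, transposing them is
  a lattice translation, and so $c_x = 0$.

  The constant $C(\tau)$ is found by putting $u_j = j/N$. By the Jacobi triple product $P(u)$ is then an
  explicit eta quotient times a Vandermonde determinant of roots of unity. The sum is the same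
  determinant times $G = \sum_{k \in \mathbb{Z}^N, \sum k = 0} q^{(\rho + N k)^2/2N}$. Multiplying $G$
  by $\sum_s q^{s^2/2}$ removes the condition $\sum k = 0$; what results is a product of
  one-dimensional theta series, evaluated by the triple product again.
\<close>

section \<open>The Jacobi triple product\<close>

text \<open>The \<open>u_i\<close> are left free because the constant is found at a point that the
  substitution u_i = a_i z need not reach. At u_j = j/N every e(u_j N k_j) is 1, so a permutation
  and a lattice translation contribute independent factors, and the alternating sum over
  permutations separates from \<open>G\<close>. The theta product is nonzero there, hence so is
  C(\<tau>). This matters twice: the expansion only shows that the series multiplied by C(\<tau>)
  converges, and dividing by the constant gives summability of the series itself for every
  \<open>u\<close>. The sign (-1)^(n(n+1)/2) is a matter of orientation: the theta factor of a pair
  i < j carries e(u_i) - e(u_j), the determinant carries e(u_j) - e(u_i). The root lattice condition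
  in \<open>G\<close> couples the coordinates and prevents a direct evaluation; it can be removed
  because the slices sum k = s of Z^N all carry the same sum up to the factor q^(s^2/2).\<close>

lemma cpow_add: "cpow w (s + t) = cpow w s * cpow w t"
  by (simp add: cpow_def algebra_simps exp_add)

lemma cpow_0 [simp]: "cpow w 0 = 1" "cpow 0 s = 1"
  by (simp_all add: cpow_def)

lemma cpow_nonzero [simp]: "cpow w s \<noteq> 0"
  by (simp add: cpow_def)

lemma cpow_add_left: "cpow (w + v) s = cpow w s * cpow v s"
  by (simp add: cpow_def algebra_simps exp_add)

lemma cpow_mult_of_real: "cpow (of_real c * w) s = cpow w (c * s)"
  by (simp add: cpow_def algebra_simps)

lemma cpow_minus: "cpow w (- s) = inverse (cpow w s)" "cpow (- w) s = inverse (cpow w s)"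
  by (simp_all add: cpow_def exp_minus)

lemma cpow_sum: "cpow w (\<Sum>i\<in>A. f i) = (\<Prod>i\<in>A. cpow w (f i))"
  by (induction A rule: infinite_finite_induct) (simp_all add: cpow_add)

lemma cpow_power: "cpow w s ^ k = cpow w (of_nat k * s)"
  by (simp add: cpow_def exp_of_nat_mult[symmetric] algebra_simps)

lemma cpow_int_period: "cpow (of_int k) (of_int m) = 1"
proof -
  have "cpow (of_int k) (of_int m) = exp (2 * of_int (k * m) * of_real pi * \<i>)"
    by (simp add: cpow_def algebra_simps)
  also have "\<dots> = 1"
    using exp_integer_2pi[of "of_int (k * m)"] by (simp add: mult.assoc)
  finally show ?thesis .
qed

lemma cpow_half_int: "cpow (1/2) (of_int k) = (if even k then 1 else -1)"
proof (cases "even k")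
  case True
  then obtain m where "k = 2 * m" by blast
  then have "cpow (1/2) (of_int k) = cpow (of_int m) (of_int 1)"
    by (simp add: cpow_def algebra_simps)
  then show ?thesis using True by (simp only: cpow_int_period) simp
next
  case False
  then obtain m where "k = 2 * m + 1" by (metis oddE)
  then have "cpow (1/2) (of_int k) = cpow (of_int m) (of_int 1) * exp (of_real pi * \<i>)"
    by (simp add: cpow_def algebra_simps flip: exp_add)
  then show ?thesis using False by (simp only: cpow_int_period) simp
qed

lemma norm_cpow: "norm (cpow w s) = exp (- 2 * pi * s * Im w)"
  by (simp add: cpow_def)

lemma norm_cpow_less_1: "Im \<tau> > 0 \<Longrightarrow> s > 0 \<Longrightarrow> norm (cpow \<tau> s) < 1"
  by (simp add: norm_cpow)

section \<open>Convergence of Gaussian series over the integers\<close>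

lemma summable_exp_abs_int: "(\<lambda>k::int. exp (- \<bar>of_int k\<bar>) :: real) summable_on UNIV"
proof -
  have s: "(\<lambda>k::nat. exp (- real k)) summable_on UNIV"
  proof (rule norm_summable_imp_summable_on)
    have "summable (\<lambda>k. (exp (-1) :: real) ^ k)"
      by (rule summable_geometric) simp
    then show "summable (\<lambda>k. norm (exp (- real k)))"
      by (simp add: exp_of_nat_mult[symmetric])
  qed
  have "(\<lambda>k::int. exp (- \<bar>of_int k\<bar>) :: real) summable_on range int"
    using s by (subst summable_on_reindex) (simp_all add: o_def)
  moreover have "(\<lambda>k::int. exp (- \<bar>of_int k\<bar>) :: real) summable_on range (\<lambda>k. - int k)"
    using s by (subst summable_on_reindex) (simp_all add: o_def inj_on_def)
  ultimately have "(\<lambda>k::int. exp (- \<bar>of_int k\<bar>) :: real) summable_on (range int \<union> range (\<lambda>k. - int k))"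
    by (rule summable_on_union)
  moreover have "range int \<union> range (\<lambda>k. - int k) = UNIV"
  proof -
    have "x \<in> range int \<union> range (\<lambda>k. - int k)" for x
      by (cases x rule: int_cases2) auto
    then show ?thesis by blast
  qed
  ultimately show ?thesis by simp
qed

text \<open>Completing the square bounds the quadratic exponent. The rate \<beta> exceeds the growth
  2 pi |Im z| of the exponential factor by one, so that exp(-|k|) is left over as a summable
  majorant.\<close>

lemma gaussian_abs_summable:
  assumes "Im \<tau> > 0" "A > 0"
  shows "(\<lambda>k::int. cpow \<tau> (A * of_int k ^ 2) * cpow z (of_int k)) summable_on UNIV"
proof -
  define \<alpha> where "\<alpha> = 2 * pi * A * Im \<tau>"
  define \<beta> where "\<beta> = 2 * pi * \<bar>Im z\<bar> + 1"
  have "\<alpha> > 0" using assms by (simp add: \<alpha>_def)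
  have le: "norm (cpow \<tau> (A * of_int k ^ 2) * cpow z (of_int k)) \<le> exp (\<beta>^2 / (4*\<alpha>)) * exp (- \<bar>of_int k\<bar>)"
    for k :: int
  proof -
    define t where "t = \<bar>real_of_int k\<bar>"
    have "- 2 * pi * of_int k * Im z \<le> 2 * pi * (t * \<bar>Im z\<bar>)"
    proof -
      have "- (of_int k * Im z) \<le> t * \<bar>Im z\<bar>"
        unfolding t_def abs_mult[symmetric] by linarith
      then have "2 * pi * - (of_int k * Im z) \<le> 2 * pi * (t * \<bar>Im z\<bar>)"
        by (intro mult_left_mono) auto
      then show ?thesis by (simp add: algebra_simps)
    qed
    moreover have "- \<alpha> * t^2 + \<beta> * t \<le> \<beta>^2 / (4*\<alpha>)"
    proof -
      have "0 \<le> (2 * \<alpha> * t - \<beta>)^2 / (4 * \<alpha>)" using \<open>\<alpha> > 0\<close> by simp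
      also have "\<dots> = \<alpha> * t^2 - \<beta> * t + \<beta>^2 / (4*\<alpha>)"
        using \<open>\<alpha> > 0\<close> by (simp add: field_simps power2_eq_square)
      finally show ?thesis by simp
    qed
    ultimately have "- \<alpha> * t^2 - 2 * pi * of_int k * Im z \<le> \<beta>^2 / (4*\<alpha>) - t"
      by (simp add: \<beta>_def algebra_simps)
    then show ?thesis
      by (simp add: norm_mult norm_cpow t_def \<alpha>_def algebra_simps flip: exp_add)
  qed
  show ?thesis
    unfolding summable_on_iff_abs_summable_on_complex
  proof (rule Infinite_Sum.abs_summable_on_comparison_test'[where g = "\<lambda>k. exp (\<beta>^2 / (4*\<alpha>)) * exp (- \<bar>of_int k\<bar>)"])
    show "(\<lambda>k::int. exp (\<beta>^2 / (4*\<alpha>)) * exp (- \<bar>of_int k\<bar>)) summable_on UNIV"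
      by (intro summable_on_cmult_right summable_exp_abs_int)
  qed (use le in auto)
qed

text \<open>Tannery's theorem, transported along the enumeration \<open>int_decode\<close>;
  unconditional summability makes the order harmless. It carries the finite triple product to the
  infinite one.\<close>

lemma infsum_dominated_convergence_int:
  fixes f :: "nat \<Rightarrow> int \<Rightarrow> complex"
  assumes lim: "\<And>k. (\<lambda>M. f M k) \<longlonglongrightarrow> h k"
    and bound: "\<And>M k. norm (f M k) \<le> g k"
    and g: "g summable_on UNIV"
  shows "(\<lambda>M. infsum (f M) UNIV) \<longlonglongrightarrow> infsum h UNIV"
proof -
  have bij: "bij_betw int_decode UNIV UNIV" by (rule bij_int_decode)
  have conv: "infsum u UNIV = (\<Sum>k. u (int_decode k))" if "u summable_on UNIV" for u :: "int \<Rightarrow> complex"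
  proof -
    have "(u has_sum infsum u UNIV) UNIV"
      using that by simp
    then have "((\<lambda>k. u (int_decode k)) has_sum infsum u UNIV) UNIV"
      using has_sum_reindex_bij_betw[OF bij] by blast
    then show ?thesis
      using has_sum_imp_sums sums_unique by blast
  qed
  have fs: "f M summable_on UNIV" for M
    by (simp only: summable_on_iff_abs_summable_on_complex, rule Infinite_Sum.abs_summable_on_comparison_test'[OF g]) (use bound in auto)
  have hle: "norm (h k) \<le> g k" for k
    by (rule LIMSEQ_le_const2[OF tendsto_norm[OF lim]]) (use bound in auto)
  have hs: "h summable_on UNIV"
    by (simp only: summable_on_iff_abs_summable_on_complex, rule Infinite_Sum.abs_summable_on_comparison_test'[OF g]) (use hle in auto)
  have "summable (\<lambda>k. g (int_decode k))"
    using g summable_on_reindex_bij_betw[OF bij] summable_on_imp_summable by blast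
  then have "(\<lambda>M. \<Sum>k. f M (int_decode k)) \<longlonglongrightarrow> (\<Sum>k. h (int_decode k))"
    using tannerys_theorem[of "\<lambda>k M. f M (int_decode k)" "\<lambda>k. h (int_decode k)" sequentially "\<lambda>k. g (int_decode k)"]
    using lim bound by (simp add: case_prod_unfold)
  then show "(\<lambda>M. infsum (f M) UNIV) \<longlonglongrightarrow> infsum h UNIV"
    by (simp add: conv fs hs)
qed

section \<open>Finite q-Pochhammer symbols (q; q)_K and the q-binomial theorem\<close>

definition qpoch :: "complex \<Rightarrow> nat \<Rightarrow> complex" where
  "qpoch q K = (\<Prod>j<K. 1 - q ^ Suc j)"

lemma qpoch_0 [simp]: "qpoch q 0 = 1"
  by (simp add: qpoch_def)

lemma qpoch_Suc: "qpoch q (Suc K) = qpoch q K * (1 - q ^ Suc K)"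
  by (simp add: qpoch_def)

lemma power_Suc_neq_1: "norm q < 1 \<Longrightarrow> (q::complex) ^ Suc j \<noteq> 1"
proof
  assume "norm q < 1" "q ^ Suc j = 1"
  then have "norm q ^ Suc j = 1" by (metis norm_one norm_power)
  moreover have "norm q * norm q ^ j \<le> norm q * 1"
    using \<open>norm q < 1\<close> by (intro mult_left_mono power_le_one) auto
  ultimately show False using \<open>norm q < 1\<close> by simp
qed

lemma qpoch_nonzero: "norm q < 1 \<Longrightarrow> qpoch q K \<noteq> 0"
  using power_Suc_neq_1[of q] by (simp add: qpoch_def del: power_Suc)

lemma power_0_choose_2: "(q::complex) ^ (0 choose 2) = 1"
  by (simp only: binomial_eq_0 zero_less_numeral power_0)

text \<open>The coefficients contain Gaussian binomials written as quotients; |q| < 1 makes every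
  denominator nonzero. The induction on \<open>K\<close> rests on the q-Pascal rule.\<close>

lemma q_binomial_theorem:
  assumes q: "norm q < 1"
  shows "(\<Prod>j<K. 1 + y * q ^ j) =
    (\<Sum>k\<le>K. q ^ (k choose 2) * (qpoch q K / (qpoch q k * qpoch q (K - k))) * y ^ k)"
proof (induction K)
  case 0
  then show ?case by (simp add: power_0_choose_2)
next
  case (Suc K)
  define c where "c K k = q ^ (k choose 2) * (qpoch q K / (qpoch q k * qpoch q (K - k)))" for K k
  have nz: "qpoch q k \<noteq> 0" for k using qpoch_nonzero[OF q] .
  have nz': "1 - q ^ Suc k \<noteq> 0" for k using power_Suc_neq_1[OF q, of k] by simp
  have c0: "c K 0 = 1" for K by (simp add: c_def nz power_0_choose_2)
  have tri: "Suc k choose 2 = (k choose 2) + k" for k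
    by (simp add: numeral_2_eq_2)
  have top: "c (Suc K) (Suc K) = q ^ K * c K K"
    by (simp add: c_def nz tri power_add del: binomial_Suc_Suc)
  have step: "c (Suc K) (Suc k) = c K (Suc k) + q ^ K * c K k" if kK: "k < K" for k
  proof -
    obtain d where K: "K = Suc (k + d)" using less_imp_Suc_add[OF kK] by blast
    have [simp]: "Suc K - Suc k = Suc d" "K - Suc k = d" "K - k = Suc d" using K by auto
    have p: "q ^ K = q ^ k * q ^ Suc d" using K by (simp add: power_add)
    have p': "q ^ Suc K = q ^ Suc k * q ^ Suc d" using K by (simp add: power_add)
    define A where "A = q ^ Suc k"
    define B where "B = q ^ Suc d"
    have A: "1 - A \<noteq> 0" and B: "1 - B \<noteq> 0" using nz' by (auto simp: A_def B_def)
    \<comment> \<open>The q-Pascal rule as a partial fraction: 1 - A B = (1 - B) + B (1 -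
      A).\<close>
    have id: "(1 - A * B) / ((1 - A) * (1 - B)) = 1 / (1 - A) + B / (1 - B)"
      using A B by (simp add: field_simps)
    have "c (Suc K) (Suc k) = q ^ (Suc k choose 2) * qpoch q K / (qpoch q k * qpoch q d) * ((1 - A * B) / ((1 - A) * (1 - B)))"
      by (simp add: c_def qpoch_Suc[of q K] p' qpoch_Suc[of q k] qpoch_Suc[of q d] A_def B_def mult_ac del: power_Suc binomial_Suc_Suc)
    also have "\<dots> = q ^ (Suc k choose 2) * qpoch q K / (qpoch q k * qpoch q d) / (1 - A)
       + q ^ (Suc k choose 2) * qpoch q K / (qpoch q k * qpoch q d) * B / (1 - B)"
      unfolding id by (simp add: distrib_left)
    also have "q ^ (Suc k choose 2) * qpoch q K / (qpoch q k * qpoch q d) / (1 - A) = c K (Suc k)"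
      by (simp add: c_def qpoch_Suc[of q k] A_def del: power_Suc binomial_Suc_Suc)
    also have "q ^ (Suc k choose 2) * qpoch q K / (qpoch q k * qpoch q d) * B / (1 - B) = q ^ K * c K k"
      by (simp add: c_def qpoch_Suc[of q d] p B_def tri power_add mult_ac del: power_Suc binomial_Suc_Suc)
    finally show ?thesis .
  qed
  have "(\<Prod>j<Suc K. 1 + y * q ^ j) = (\<Sum>k\<le>K. c K k * y ^ k) * (1 + y * q ^ K)"
    using Suc.IH by (simp add: c_def)
  also have "\<dots> = (\<Sum>k\<le>K. c K k * y ^ k) + (\<Sum>k\<le>K. q ^ K * c K k * y ^ Suc k)"
    by (simp add: distrib_left sum_distrib_right sum_distrib_left sum.distrib mult_ac)
  also have "(\<Sum>k\<le>K. c K k * y ^ k) = 1 + (\<Sum>k<K. c K (Suc k) * y ^ Suc k)"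
    by (simp add: lessThan_Suc_atMost[symmetric] sum.lessThan_Suc_shift c0 del: sum.lessThan_Suc)
  also have "(\<Sum>k\<le>K. q ^ K * c K k * y ^ Suc k) = (\<Sum>k<K. q ^ K * c K k * y ^ Suc k) + q ^ K * c K K * y ^ Suc K"
    by (simp add: lessThan_Suc_atMost[symmetric])
  also have "1 + (\<Sum>k<K. c K (Suc k) * y ^ Suc k) + ((\<Sum>k<K. q ^ K * c K k * y ^ Suc k) + q ^ K * c K K * y ^ Suc K)
     = 1 + (\<Sum>k<K. c (Suc K) (Suc k) * y ^ Suc k) + c (Suc K) (Suc K) * y ^ Suc K"
    by (simp add: step top sum.distrib[symmetric] distrib_right del: power_Suc)
  also have "\<dots> = (\<Sum>k\<le>Suc K. c (Suc K) k * y ^ k)"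
    by (simp add: lessThan_Suc_atMost[symmetric] sum.lessThan_Suc_shift[of _ "Suc K"] c0 del: sum.lessThan_Suc power_Suc)
       (simp add: add.assoc)
  finally show ?case by (simp add: c_def)
qed


section \<open>Infinite products (c; q)_\<infinity> and the Euler function\<close>

definition qprod :: "complex \<Rightarrow> complex \<Rightarrow> complex" where
  "qprod \<tau> c = (\<Prod>j. 1 - c * cpow \<tau> 1 ^ j)"

lemma convergent_qprod:
  assumes "Im \<tau> > 0"
  shows "convergent_prod (\<lambda>j. 1 - c * cpow \<tau> 1 ^ j)"
proof -
  have "norm (cpow \<tau> 1) < 1" using norm_cpow_less_1[OF assms] by simp
  then have "summable (\<lambda>j. norm c * norm (cpow \<tau> 1) ^ j)"
    by (intro summable_mult summable_geometric) simp
  then have "summable (\<lambda>j. norm (1 - c * cpow \<tau> 1 ^ j - 1))"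
    by (simp add: norm_mult norm_power)
  then show ?thesis
    by (intro abs_convergent_prod_imp_convergent_prod summable_imp_abs_convergent_prod)
qed

lemma qprod_LIMSEQ:
  assumes "Im \<tau> > 0"
  shows "(\<lambda>M. \<Prod>j<M. 1 - c * cpow \<tau> 1 ^ j) \<longlonglongrightarrow> qprod \<tau> c"
  using has_prod_imp_tendsto'[OF convergent_prod_has_prod[OF convergent_qprod[OF assms]]]
  by (simp add: qprod_def)

lemma qprod_split_head:
  assumes "Im \<tau> > 0"
  shows "qprod \<tau> c = (1 - c) * qprod \<tau> (c * cpow \<tau> 1)"
proof -
  have "(\<lambda>M. \<Prod>j<Suc M. 1 - c * cpow \<tau> 1 ^ j) \<longlonglongrightarrow> (1 - c) * qprod \<tau> (c * cpow \<tau> 1)"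
    using tendsto_mult_left[OF qprod_LIMSEQ[OF assms, of "c * cpow \<tau> 1"], of "1 - c"]
    by (simp add: prod.lessThan_Suc_shift mult.assoc del: prod.lessThan_Suc)
  moreover have "(\<lambda>M. \<Prod>j<Suc M. 1 - c * cpow \<tau> 1 ^ j) \<longlonglongrightarrow> qprod \<tau> c"
    using qprod_LIMSEQ[OF assms] LIMSEQ_Suc by blast
  ultimately show ?thesis by (rule LIMSEQ_unique[symmetric])
qed

lemma qprod_nonzero:
  assumes "Im \<tau> > 0" "\<And>j. c * cpow \<tau> 1 ^ j \<noteq> 1"
  shows "qprod \<tau> c \<noteq> 0"
  unfolding qprod_def
  by (rule prodinf_nonzero[OF convergent_qprod[OF assms(1)]]) (use assms(2) in \<open>metis eq_iff_diff_eq_0\<close>)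

lemma qprod_nonzero':
  assumes "Im \<tau> > 0" "norm c < 1"
  shows "qprod \<tau> c \<noteq> 0"
proof (rule qprod_nonzero[OF assms(1)])
  fix j
  have "norm c * norm (cpow \<tau> 1) ^ j \<le> norm c * 1"
    using norm_cpow_less_1[OF assms(1), of 1] by (intro mult_left_mono power_le_one) auto
  then have "norm (c * cpow \<tau> 1 ^ j) < 1"
    using assms(2) by (simp add: norm_mult norm_power)
  then show "c * cpow \<tau> 1 ^ j \<noteq> 1" by force
qed

definition euler_phi :: "complex \<Rightarrow> complex" where
  "euler_phi \<tau> = qprod \<tau> (cpow \<tau> 1)"

lemma euler_phi_nonzero: "Im \<tau> > 0 \<Longrightarrow> euler_phi \<tau> \<noteq> 0"
  unfolding euler_phi_def using norm_cpow_less_1 by (intro qprod_nonzero') auto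

lemma dedekind_eta_eq: "dedekind_eta \<tau> = cpow \<tau> (1/24) * euler_phi \<tau>"
  by (simp add: dedekind_eta_def euler_phi_def qprod_def)

lemma dedekind_eta_nonzero: "Im \<tau> > 0 \<Longrightarrow> dedekind_eta \<tau> \<noteq> 0"
  by (simp add: dedekind_eta_eq euler_phi_nonzero)

lemma qpoch_LIMSEQ:
  assumes "Im \<tau> > 0"
  shows "qpoch (cpow \<tau> 1) \<longlonglongrightarrow> euler_phi \<tau>"
  using qprod_LIMSEQ[OF assms, of "cpow \<tau> 1"] by (simp add: euler_phi_def qpoch_def[abs_def])

text \<open>This is the q-binomial theorem for \<open>2 * M\<close> factors with the index recentred
  at \<open>M\<close>. The choice of \<open>y\<close> makes the factors 1 + \<zeta> q^s run over the
  half-integers s from 1/2 - M to M - 1/2; positive s give the first product, negative s the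
  second.\<close>

lemma finite_jacobi_triple_product:
  assumes "Im \<tau> > 0"
  defines "q \<equiv> cpow \<tau> 1"
  shows "(\<Prod>j<M. 1 - (- cpow \<tau> (1/2) * cpow z 1) * q ^ j) * (\<Prod>j<M. 1 - (- cpow \<tau> (1/2) * cpow (-z) 1) * q ^ j) =
    (\<Sum>k\<le>2*M. qpoch q (2*M) / (qpoch q k * qpoch q (2*M-k)) *
       (cpow \<tau> ((real k - real M)^2 / 2) * cpow z (real k - real M)))"
proof -
  define y where "y = cpow z 1 * cpow \<tau> (1/2 - real M)"
  have q: "norm q < 1" using norm_cpow_less_1[OF assms(1), of 1] by (simp add: q_def)
  have qk: "q ^ k = cpow \<tau> (real k)" for k by (simp add: q_def cpow_power)
  \<comment> \<open>Factors with negative exponent are turned over by 1 + w = w (1 + 1/w). The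
    monomials w are collected in \<open>prefac\<close> and cancel against the recentring of the
    sum.\<close>
  have fac: "1 + y * q ^ (M - 1 - i) = cpow z 1 * cpow \<tau> (- real i - 1/2) * (1 - (- cpow \<tau> (1/2) * cpow (-z) 1) * q ^ i)"
    if "i < M" for i
  proof -
    have "real (M - 1 - i) = real M - 1 - real i" using that by (simp add: of_nat_diff)
    then have "y * q ^ (M - 1 - i) = cpow z 1 * cpow \<tau> (- real i - 1/2)"
      by (simp add: y_def qk mult.assoc algebra_simps flip: cpow_add)
    moreover have "cpow z 1 * cpow \<tau> (- real i - 1/2) * ((cpow \<tau> (1/2) * cpow (-z) 1) * q ^ i) = 1"
    proof -
      have "cpow z 1 * cpow \<tau> (- real i - 1/2) * ((cpow \<tau> (1/2) * cpow (-z) 1) * q ^ i)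
        = (cpow z 1 * cpow (-z) 1) * (cpow \<tau> (- real i - 1/2) * cpow \<tau> (1/2) * cpow \<tau> (real i))"
        by (simp add: qk)
      then show ?thesis by (simp add: cpow_minus flip: cpow_add)
    qed
    ultimately show ?thesis by (simp add: distrib_left)
  qed
  have prefac: "(\<Prod>i<M. cpow z 1 * cpow \<tau> (- real i - 1/2)) = cpow z (real M) * cpow \<tau> (- ((real M)^2) / 2)"
  proof -
    have "(\<Sum>i<M. - real i - 1/2) = - ((real M)^2) / 2"
      by (induction M) (simp_all add: power2_eq_square field_simps)
    then show ?thesis by (simp add: prod.distrib cpow_power flip: cpow_sum)
  qed
  have "(\<Prod>j<2*M. 1 + y * q ^ j) = (\<Prod>j<M. 1 + y * q ^ j) * (\<Prod>j<M. 1 + y * q ^ (M + j))"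
    using prod.atLeastLessThan_concat[of 0 M "2*M" "\<lambda>j. 1 + y * q ^ j"]
      prod.shift_bounds_nat_ivl[of "\<lambda>j. 1 + y * q ^ j" 0 M M]
    by (simp add: atLeast0LessThan mult_2 add.commute)
  also have "(\<Prod>j<M. 1 + y * q ^ (M + j)) = (\<Prod>j<M. 1 - (- cpow \<tau> (1/2) * cpow z 1) * q ^ j)"
  proof -
    have "y * q ^ (M + j) = cpow \<tau> (1/2) * cpow z 1 * q ^ j" for j
    proof -
      have "y * q ^ (M + j) = cpow z 1 * (cpow \<tau> (1/2 - real M) * cpow \<tau> (real M)) * q ^ j"
        by (simp add: y_def qk cpow_add)
      then show ?thesis by (simp flip: cpow_add)
    qed
    then show ?thesis by simp
  qed
  also have "(\<Prod>j<M. 1 + y * q ^ j) = (\<Prod>i<M. 1 + y * q ^ (M - 1 - i))"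
    using prod.nat_diff_reindex[of "\<lambda>j. 1 + y * q ^ j" M] by simp
  also have "\<dots> = (\<Prod>i<M. cpow z 1 * cpow \<tau> (- real i - 1/2)) * (\<Prod>j<M. 1 - (- cpow \<tau> (1/2) * cpow (-z) 1) * q ^ j)"
    unfolding prod.distrib[symmetric] by (rule prod.cong) (use fac in auto)
  finally have "(\<Prod>j<2*M. 1 + y * q ^ j) = cpow z (real M) * cpow \<tau> (- ((real M)^2) / 2) *
      ((\<Prod>j<M. 1 - (- cpow \<tau> (1/2) * cpow z 1) * q ^ j) * (\<Prod>j<M. 1 - (- cpow \<tau> (1/2) * cpow (-z) 1) * q ^ j))"
    unfolding prefac by (simp add: mult_ac)
  moreover have "(\<Prod>j<2*M. 1 + y * q ^ j) = cpow z (real M) * cpow \<tau> (- ((real M)^2) / 2) *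
      (\<Sum>k\<le>2*M. qpoch q (2*M) / (qpoch q k * qpoch q (2*M-k)) *
       (cpow \<tau> ((real k - real M)^2 / 2) * cpow z (real k - real M)))"
  proof -
    have "q ^ (k choose 2) * c * y ^ k = cpow z (real M) * cpow \<tau> (- ((real M)^2) / 2) *
       (c * (cpow \<tau> ((real k - real M)^2 / 2) * cpow z (real k - real M)))" for c k
    proof -
      have ch: "real (k choose 2) = real k * (real k - 1) / 2"
      proof (cases k)
        case (Suc m)
        have "2 * (k choose 2) = k * (k - 1)"
          unfolding choose_two by (rule dvd_mult_div_cancel) auto
        then have "2 * real (k choose 2) = real k * real (k - 1)" by (metis of_nat_mult of_nat_numeral)
        then show ?thesis using Suc by simp
      qed (simp add: numeral_2_eq_2)
      have "q ^ (k choose 2) * y ^ k = cpow z (real k) * cpow \<tau> (real (k choose 2) + real k * (1/2 - real M))"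
        by (simp add: qk y_def power_mult_distrib cpow_power cpow_add)
      also have "real (k choose 2) + real k * (1/2 - real M) = - ((real M)^2) / 2 + (real k - real M)^2 / 2"
        unfolding ch by (simp add: power2_eq_square field_simps)
      also have "cpow z (real k) = cpow z (real M) * cpow z (real k - real M)"
        by (simp flip: cpow_add)
      finally show ?thesis unfolding cpow_add by (simp only: mult_ac)
    qed
    then show ?thesis unfolding q_binomial_theorem[OF q] sum_distrib_left by (intro sum.cong refl)
  qed
  ultimately show ?thesis by simp
qed

text \<open>The limit M -> \<infinity> of the finite version: each quotient of \<open>qpoch\<close>
  values tends to \<phi> / (\<phi> * \<phi>). Since \<open>qpoch\<close> converges to a nonzero
  limit, both its values and their inverses are bounded, so a fixed multiple of the theta series is
  a majorant.\<close>

theorem jacobi_triple_product: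
  assumes "Im \<tau> > 0"
  shows "((\<lambda>m::int. cpow \<tau> (of_int m ^ 2 / 2) * cpow z (of_int m)) has_sum
     euler_phi \<tau> * qprod \<tau> (- cpow \<tau> (1/2) * cpow z 1) * qprod \<tau> (- cpow \<tau> (1/2) * cpow (- z) 1)) UNIV"
proof -
  define q where "q = cpow \<tau> 1"
  define t where "t m = cpow \<tau> (of_int m ^ 2 / 2) * cpow z (of_int m)" for m :: int
  \<comment> \<open>Extension by zero puts all the finite sums on one index set, as dominated
    convergence requires.\<close>
  define f where "f M m = (if m \<in> {- int M..int M}
     then qpoch q (2*M) / (qpoch q (nat (int M + m)) * qpoch q (nat (int M - m))) * t m else 0)" for M m
  define \<phi> where "\<phi> = euler_phi \<tau>"
  have q: "norm q < 1" using norm_cpow_less_1[OF assms(1), of 1] by (simp add: q_def)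
  have \<phi>: "\<phi> \<noteq> 0" using euler_phi_nonzero assms by (simp add: \<phi>_def)
  have lim: "qpoch q \<longlonglongrightarrow> \<phi>" using qpoch_LIMSEQ[OF assms] by (simp add: q_def \<phi>_def)
  have t_sum: "t summable_on UNIV"
    using gaussian_abs_summable[OF assms, of "1/2" z] by (simp add: t_def[abs_def])
  obtain K where K: "\<And>k. norm (qpoch q k) \<le> K"
    using convergent_imp_Bseq[OF convergentI[OF lim]] by (auto simp: Bseq_def)
  have "(\<lambda>k. inverse (qpoch q k)) \<longlonglongrightarrow> inverse \<phi>"
    using lim \<phi> by (intro tendsto_inverse)
  then obtain K' where K': "\<And>k. norm (inverse (qpoch q k)) \<le> K'"
    using convergent_imp_Bseq[OF convergentI, of "\<lambda>k. inverse (qpoch q k)"] by (auto simp: Bseq_def)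
  have K0: "0 \<le> K" "0 \<le> K'" using K[of 0] K'[of 0] norm_ge_zero order_trans by blast+
  have fsum: "infsum (f M) UNIV = (\<Prod>j<M. 1 - (- cpow \<tau> (1/2) * cpow z 1) * q ^ j) *
     (\<Prod>j<M. 1 - (- cpow \<tau> (1/2) * cpow (-z) 1) * q ^ j)" for M
  proof -
    have "infsum (f M) UNIV = infsum (f M) {- int M..int M}"
      by (rule infsum_cong_neutral) (auto simp: f_def)
    also have "\<dots> = sum (f M) {- int M..int M}" by simp
    also have "\<dots> = (\<Sum>k\<le>2*M. f M (int k - int M))"
      by (rule sum.reindex_bij_witness[where j = "\<lambda>m. nat (m + int M)" and i = "\<lambda>k. int k - int M"]) auto
    also have "\<dots> = (\<Sum>k\<le>2*M. qpoch q (2*M) / (qpoch q k * qpoch q (2*M-k)) *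
       (cpow \<tau> ((real k - real M)^2 / 2) * cpow z (real k - real M)))"
    proof (rule sum.cong)
      fix k assume "k \<in> {..2*M}"
      then have "nat (int M - (int k - int M)) = 2 * M - k" "int k - int M \<in> {- int M..int M}" by auto
      then show "f M (int k - int M) = qpoch q (2*M) / (qpoch q k * qpoch q (2*M-k)) *
       (cpow \<tau> ((real k - real M)^2 / 2) * cpow z (real k - real M))"
        by (simp add: f_def t_def)
    qed simp
    also have "\<dots> = (\<Prod>j<M. 1 - (- cpow \<tau> (1/2) * cpow z 1) * q ^ j) *
     (\<Prod>j<M. 1 - (- cpow \<tau> (1/2) * cpow (-z) 1) * q ^ j)"
      unfolding q_def by (rule finite_jacobi_triple_product[OF assms, symmetric])
    finally show ?thesis .
  qed
  have flim: "(\<lambda>M. f M m) \<longlonglongrightarrow> \<phi> / (\<phi> * \<phi>) * t m" for m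
  proof -
    have a: "filterlim (\<lambda>M. nat (int M + m)) sequentially sequentially"
      unfolding filterlim_at_top eventually_sequentially
    proof
      fix Z show "\<exists>N. \<forall>n\<ge>N. Z \<le> nat (int n + m)" by (rule exI[of _ "Z + nat \<bar>m\<bar>"]) auto
    qed
    have b: "filterlim (\<lambda>M. nat (int M - m)) sequentially sequentially"
      unfolding filterlim_at_top eventually_sequentially
    proof
      fix Z show "\<exists>N. \<forall>n\<ge>N. Z \<le> nat (int n - m)" by (rule exI[of _ "Z + nat \<bar>m\<bar>"]) auto
    qed
    have c: "filterlim (\<lambda>M::nat. 2 * M) sequentially sequentially"
      by (rule filterlim_subseq) (simp add: strict_mono_def)
    have "(\<lambda>M. qpoch q (2*M) / (qpoch q (nat (int M + m)) * qpoch q (nat (int M - m))) * t m)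
       \<longlonglongrightarrow> \<phi> / (\<phi> * \<phi>) * t m"
      by (intro tendsto_intros filterlim_compose[OF lim a] filterlim_compose[OF lim b]
           filterlim_compose[OF lim c]) (use \<phi> in auto)
    moreover have "\<forall>\<^sub>F M in sequentially.
       qpoch q (2*M) / (qpoch q (nat (int M + m)) * qpoch q (nat (int M - m))) * t m = f M m"
      unfolding eventually_sequentially f_def by (rule exI[of _ "nat \<bar>m\<bar>"]) auto
    ultimately show ?thesis by (rule Lim_transform_eventually)
  qed
  have bound: "norm (f M m) \<le> K * (K' * K') * norm (t m)" for M m
  proof (cases "m \<in> {- int M..int M}")
    case True
    then have "norm (f M m) = norm (qpoch q (2*M)) * (norm (inverse (qpoch q (nat (int M + m))))
       * norm (inverse (qpoch q (nat (int M - m))))) * norm (t m)"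
      by (simp add: f_def norm_mult norm_divide norm_inverse divide_inverse)
    also have "\<dots> \<le> K * (K' * K') * norm (t m)"
      by (intro mult_right_mono mult_mono K K' mult_nonneg_nonneg K0) auto
    finally show ?thesis .
  next
    case False
    then have "f M m = 0" unfolding f_def by (rule if_not_P)
    then show ?thesis using K0 by simp
  qed
  have gs: "(\<lambda>m. K * (K' * K') * norm (t m)) summable_on UNIV"
    using t_sum summable_on_iff_abs_summable_on_complex by (intro summable_on_cmult_right) blast
  note dc = infsum_dominated_convergence_int[of f, OF flim bound gs]
  have "(\<lambda>M. infsum (f M) UNIV) \<longlonglongrightarrow>
     qprod \<tau> (- cpow \<tau> (1/2) * cpow z 1) * qprod \<tau> (- cpow \<tau> (1/2) * cpow (- z) 1)"
    unfolding fsum q_def by (intro tendsto_mult qprod_LIMSEQ assms)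
  then have "infsum (\<lambda>m. \<phi> / (\<phi> * \<phi>) * t m) UNIV =
     qprod \<tau> (- cpow \<tau> (1/2) * cpow z 1) * qprod \<tau> (- cpow \<tau> (1/2) * cpow (- z) 1)"
    using dc LIMSEQ_unique by blast
  then have "infsum t UNIV = \<phi> * (qprod \<tau> (- cpow \<tau> (1/2) * cpow z 1) * qprod \<tau> (- cpow \<tau> (1/2) * cpow (- z) 1))"
    unfolding infsum_cmult_right' using \<phi> by (simp add: field_simps)
  then show ?thesis
    using has_sum_infsum[OF t_sum] by (simp add: t_def[abs_def] \<phi>_def mult_ac)
qed

section \<open>Signs of permutations and the Vandermonde determinant\<close>

definition pairs :: "nat \<Rightarrow> (nat \<times> nat) set" where
  "pairs n = {(i, j). i < j \<and> j \<le> n}"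

lemma finite_pairs [simp]: "finite (pairs n)"
  by (rule finite_subset[of _ "{..n} \<times> {..n}"]) (auto simp: pairs_def)

context comm_monoid_set
begin

text \<open>Stated for an arbitrary commutative monoid because products (weights, theta factors) and
  sums (exponents) over i < j are both regrouped by rows in this way.\<close>

lemma pairs_symmetrize:
  "F (\<lambda>(i, j). g i j \<^bold>* g j i) (pairs n) = F (\<lambda>i. F (g i) ({0..n} - {i})) {0..n}"
proof -
  have "F (\<lambda>i. F (g i) ({0..n} - {i})) {0..n} = F (\<lambda>(i, j). g i j) (Sigma {0..n} (\<lambda>i. {0..n} - {i}))"
    by (subst Sigma) auto
  also have "Sigma {0..n} (\<lambda>i. {0..n} - {i}) = pairs n \<union> prod.swap ` pairs n"
  proof -
    have "(i, j) \<in> prod.swap ` pairs n \<longleftrightarrow> (j, i) \<in> pairs n" for i j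
      by (metis (no_types, lifting) imageE image_eqI prod.swap_def swap_simp swap_swap)
    then show ?thesis by (auto simp: pairs_def)
  qed
  also have "F (\<lambda>(i, j). g i j) (pairs n \<union> prod.swap ` pairs n) =
      F (\<lambda>(i, j). g i j) (pairs n) \<^bold>* F (\<lambda>(i, j). g i j) (prod.swap ` pairs n)"
    by (rule union_disjoint) (simp, simp, auto simp: pairs_def)
  also have "F (\<lambda>(i, j). g i j) (prod.swap ` pairs n) = F (\<lambda>(i, j). g j i) (pairs n)"
    by (subst reindex) (auto simp: o_def case_prod_unfold)
  finally show ?thesis by (simp add: distrib case_prod_unfold)
qed

lemma pairs_Suc_nested: "F (\<lambda>(i, j). g i j) (pairs n) = F (\<lambda>j. F (\<lambda>i. g i j) {..<j}) {..<Suc n}"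
proof -
  have "F (\<lambda>j. F (\<lambda>i. g i j) {..<j}) {..<Suc n} = F (\<lambda>(j, i). g i j) (Sigma {..<Suc n} (\<lambda>j. {..<j}))"
    by (subst Sigma) auto
  also have "\<dots> = F (\<lambda>(i, j). g i j) (pairs n)"
    by (rule reindex_bij_witness[where i = prod.swap and j = prod.swap]) (auto simp: pairs_def)
  finally show ?thesis by simp
qed

end

text \<open>
  The transposition reverses exactly the $2 (b - a - 1) + 1$ pairs that contain $a$ or $b$ and lie
  within $\{a, \dots, b\}$.
\<close>
lemma prod_pairs_transpose:
  fixes f :: "nat \<Rightarrow> nat \<Rightarrow> 'a::comm_ring_1"
  assumes anti: "\<And>i j. f j i = - f i j" and ab: "a < b" "b \<le> n"
  shows "(\<Prod>(i, j)\<in>pairs n. f (Transposition.transpose a b i) (Transposition.transpose a b j)) = - (\<Prod>(i, j)\<in>pairs n. f i j)"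
proof -
  define t where "t = (\<lambda>(i, j). (Transposition.transpose a b i, Transposition.transpose a b j))"
  define P where "P = pairs n"
  define C where "C = {a<..<b}"
  define D where "D = insert (b, a) (Pair b ` C \<union> (\<lambda>c. (c, a)) ` C)"
  have inj_t: "inj t" by (auto simp: t_def inj_def dest: injD[OF inj_transpose])
  have finP: "finite P" by (simp add: P_def)
  have t_t: "t (t p) = p" for p by (cases p) (simp add: t_def)
  have tP: "p \<in> t ` P \<longleftrightarrow> t p \<in> P" for p
    by (metis image_iff t_t)
  have D1: "t ` P - P = D"
  proof -
    have "(i, j) \<in> t ` P - P \<longleftrightarrow> (i, j) \<in> D" for i j
      unfolding Diff_iff tP using ab
      by (auto simp: t_def P_def pairs_def D_def C_def Transposition.transpose_def image_iff)
    then show ?thesis by auto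
  qed
  have D2: "P - t ` P = prod.swap ` D"
  proof -
    have "(i, j) \<in> P - t ` P \<longleftrightarrow> (j, i) \<in> D" for i j
      unfolding Diff_iff tP using ab
      by (auto simp: t_def P_def pairs_def D_def C_def Transposition.transpose_def image_iff)
    moreover have "(i, j) \<in> prod.swap ` D \<longleftrightarrow> (j, i) \<in> D" for i j
      by (metis (no_types, lifting) imageE image_eqI prod.swap_def swap_simp swap_swap)
    ultimately show ?thesis unfolding set_eq_iff split_paired_All by blast
  qed
  have finD: "finite D" by (simp add: D_def C_def)
  have cardD: "odd (card D)"
  proof -
    have "card D = Suc (card (Pair b ` C \<union> (\<lambda>c. (c, a)) ` C))"
      unfolding D_def by (rule card_insert_disjoint) (auto simp: C_def)
    also have "card (Pair b ` C \<union> (\<lambda>c. (c, a)) ` C) = card (Pair b ` C) + card ((\<lambda>c. (c, a)) ` C)"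
      by (rule card_Un_disjoint) (auto simp: C_def)
    also have "card (Pair b ` C) = card C" by (rule card_image) (auto simp: inj_on_def)
    also have "card ((\<lambda>c. (c, a)) ` C) = card C" by (rule card_image) (auto simp: inj_on_def)
    finally show ?thesis by simp
  qed
  have "(\<Prod>(i, j)\<in>P. f (Transposition.transpose a b i) (Transposition.transpose a b j)) = (\<Prod>(i, j)\<in>t ` P. f i j)"
    using inj_t by (subst prod.reindex) (auto simp: o_def t_def case_prod_unfold intro: inj_on_subset)
  also have "\<dots> = (\<Prod>(i, j)\<in>t ` P \<inter> P. f i j) * (\<Prod>(i, j)\<in>D. f i j)"
    using prod.Int_Diff[of "t ` P" _ P] finP D1 by auto
  also have "(\<Prod>(i, j)\<in>D. f i j) = (\<Prod>p\<in>D. (-1) * (case p of (i, j) \<Rightarrow> f j i))"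
  proof (rule prod.cong; clarify)
    fix i j show "f i j = - 1 * f j i" using anti[of i j] by simp
  qed
  also have "\<dots> = - (\<Prod>(i, j)\<in>D. f j i)"
    using cardD by (subst prod.distrib) simp
  also have "(\<Prod>(i, j)\<in>D. f j i) = (\<Prod>(i, j)\<in>prod.swap ` D. f i j)"
    by (subst prod.reindex) (auto simp: o_def case_prod_unfold)
  also have "(\<Prod>(i, j)\<in>t ` P \<inter> P. f i j) * - (\<Prod>(i, j)\<in>prod.swap ` D. f i j) = - (\<Prod>(i, j)\<in>P. f i j)"
    using prod.Int_Diff[of P "\<lambda>(i, j). f i j" "t ` P"] finP by (simp add: Int_commute D2)
  finally show ?thesis by (simp add: P_def)
qed

text \<open>Induction over transpositions. The function stays arbitrary, since the hypothesis is
  applied to \<open>f\<close> with both arguments transposed, which is again antisymmetric.\<close>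

lemma prod_pairs_permute:
  fixes f :: "nat \<Rightarrow> nat \<Rightarrow> 'a::comm_ring_1"
  assumes "p permutes {0..n}" and anti: "\<And>i j. f j i = - f i j"
  shows "(\<Prod>(i, j)\<in>pairs n. f (p i) (p j)) = of_int (sign p) * (\<Prod>(i, j)\<in>pairs n. f i j)"
proof -
  have "finite {0..n}" by simp
  from assms(1) this show ?thesis using anti
  proof (induction arbitrary: f rule: permutes_induct)
    case id
    show ?case by simp
  next
    case (swap a b p)
    have tr: "(\<Prod>(i, j)\<in>pairs n. f (Transposition.transpose a b i) (Transposition.transpose a b j)) = - (\<Prod>(i, j)\<in>pairs n. f i j)"
    proof (cases "a < b")
      case True
      then show ?thesis using swap.hyps(2) by (intro prod_pairs_transpose swap.prems) auto
    next
      case False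
      then have "b < a" "a \<le> n" using swap.hyps by auto
      then show ?thesis
        using prod_pairs_transpose[of f b a n, OF swap.prems] by (simp add: transpose_commute)
    qed
    have "permutation p" using swap.hyps finite_atLeastAtMost permutation_permutes by blast
    then have s: "sign (Transposition.transpose a b \<circ> p) = - sign p"
      using swap.hyps by (simp add: sign_compose permutation_swap_id sign_swap_id)
    show ?case
      using swap.IH[of "\<lambda>i j. f (Transposition.transpose a b i) (Transposition.transpose a b j)", OF swap.prems] tr s
      unfolding s by simp
  qed
qed

text \<open>Subtracting the candidate cancels the coefficient of degree N, so a nonzero difference
  would have degree below N and yet N distinct roots.\<close>

lemma poly_eq_smult_prod_roots:
  fixes p :: "'a::{idom, ring_char_0} poly"
  assumes "degree p \<le> N" "inj_on y {..<N}" "\<And>i. i < N \<Longrightarrow> poly p (y i) = 0"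
  shows "p = smult (coeff p N) (\<Prod>i<N. [:- y i, 1:])"
proof -
  define g where "g = (\<Prod>i<N. [:- y i, 1:])"
  define r where "r = p - smult (coeff p N) g"
  have dg: "degree g = N"
    by (simp add: g_def degree_prod_eq_sum_degree)
  have lg: "coeff g N = 1"
  proof -
    have "lead_coeff g = 1" by (simp add: g_def lead_coeff_prod)
    then show ?thesis by (simp add: dg)
  qed
  have "r = 0"
  proof (rule ccontr)
    assume "r \<noteq> 0"
    have "degree r \<le> N" unfolding r_def
      by (rule degree_diff_le) (use assms(1) dg degree_smult_le[of "coeff p N" g] in auto)
    moreover have "coeff r N = 0" by (simp add: r_def lg)
    ultimately have "degree r < N"
      using \<open>r \<noteq> 0\<close> by (metis le_neq_implies_less leading_coeff_0_iff)
    moreover have "y ` {..<N} \<subseteq> {x. poly r x = 0}"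
    proof safe
      fix i assume "i < N"
      then have "(\<Prod>j<N. y i - y j) = 0" by (intro prod_zero) auto
      then show "poly r (y i) = 0"
        using assms(3)[OF \<open>i < N\<close>] by (simp add: r_def g_def poly_prod)
    qed
    then have "card (y ` {..<N}) \<le> degree r"
      using card_mono[OF poly_roots_finite[OF \<open>r \<noteq> 0\<close>]] card_poly_roots_bound[OF \<open>r \<noteq> 0\<close>] by (blast intro: order_trans)
    ultimately show False using assms(2) by (simp add: card_image)
  qed
  then show ?thesis by (simp add: r_def g_def)
qed

text \<open>X^N - 1 splits over the N distinct powers of \<omega>. Evaluation at 1/x and
  multiplication by x^N reverses the polynomial, which is why x = 0 is treated apart.\<close>

lemma prod_roots_of_unity:
  fixes \<omega> x :: complex
  assumes "inj_on (\<lambda>i. \<omega> ^ i) {..<N}" "\<omega> ^ N = 1" "N > 0"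
  shows "(\<Prod>i<N. 1 - x * \<omega> ^ i) = 1 - x ^ N"
proof (cases "x = 0")
  case True
  then show ?thesis using assms(3) by simp
next
  case False
  define p :: "complex poly" where "p = monom 1 N - 1"
  have cp: "coeff p N = 1" using assms(3) by (simp add: p_def)
  have "p = smult (coeff p N) (\<Prod>i<N. [:- (\<omega> ^ i), 1:])"
  proof (rule poly_eq_smult_prod_roots)
    show "degree p \<le> N" unfolding p_def by (intro degree_diff_le degree_monom_le) simp
    show "poly p (\<omega> ^ i) = 0" for i
      using assms(2) by (simp add: p_def poly_monom flip: power_mult) (metis mult.commute power_mult power_one)
  qed fact
  then have "poly p (1/x) = (\<Prod>i<N. 1/x - \<omega> ^ i)"
    by (simp add: cp) (simp add: poly_prod)
  then have "x ^ N * (\<Prod>i<N. 1/x - \<omega> ^ i) = x ^ N * ((1/x) ^ N - 1)"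
    by (simp add: p_def poly_monom)
  also have "x ^ N * (\<Prod>i<N. 1/x - \<omega> ^ i) = (\<Prod>i<N. x * (1/x - \<omega> ^ i))"
    by (simp add: prod.distrib)
  finally show ?thesis using False by (simp add: right_diff_distrib power_divide)
qed

text \<open>
  As a polynomial in the last variable the sum has degree at most $N$, vanishes at the other variables
  by antisymmetry, and has the smaller determinant as its top coefficient.
\<close>
lemma vandermonde_determinant:
  fixes y :: "nat \<Rightarrow> 'a::{idom, ring_char_0}"
  assumes "inj_on y {..<N}"
  shows "(\<Sum>p | p permutes {..<N}. of_int (sign p) * (\<Prod>i<N. y i ^ p i)) = (\<Prod>j<N. \<Prod>i<j. y j - y i)"
  using assms
proof (induction N)
  case 0
  then show ?case by simp
next
  case (Suc N)
  define c where "c p = of_int (sign p) * (\<Prod>i<N. y i ^ p i)" for p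
  define V where "V = {p. p permutes {..<Suc N}}"
  define q where "q = (\<Sum>p\<in>V. smult (c p) (monom 1 (p N)))"
  have finV: "finite V" by (simp add: V_def finite_permutations)
  have pq: "poly q x = (\<Sum>p\<in>V. of_int (sign p) * (\<Prod>i<N. y i ^ p i) * x ^ p N)" for x
    by (simp add: q_def poly_sum poly_monom c_def)
  have "degree q \<le> N" unfolding q_def
  proof (rule degree_sum_le[OF finV])
    fix p assume "p \<in> V"
    then have "p N \<le> N" unfolding V_def using permutes_in_image[of p "{..<Suc N}" N] by auto
    then show "degree (smult (c p) (monom 1 (p N))) \<le> N"
      by (meson degree_monom_le degree_smult_le order_trans)
  qed
  moreover have "poly q (y k) = 0" if k: "k < N" for k
  proof -
    define t where "t = Transposition.transpose k N"
    have tperm: "t permutes {..<Suc N}" unfolding t_def using k by (intro permutes_swap_id) auto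
    \<comment> \<open>The summand with the last variable set equal to \<open>y k\<close>. The list
      of variables is then invariant under \<open>t\<close>, so composing with \<open>t\<close>
      keeps the product and reverses the sign.\<close>
    define h where "h p = of_int (sign p) * (\<Prod>i<Suc N. (if i = N then y k else y i) ^ p i)" for p
    have qh: "poly q (y k) = sum h V" unfolding pq h_def
      by (intro sum.cong) (auto simp: mult.assoc)
    have "sum h V = (\<Sum>p\<in>V. h (p \<circ> t))"
      unfolding V_def by (rule sum_permutations_compose_right[OF tperm])
    also have "\<dots> = (\<Sum>p\<in>V. - h p)"
    proof (rule sum.cong)
      fix p assume "p \<in> V"
      then have "permutation p" unfolding V_def using permutation_permutes finite_lessThan by blast
      then have s: "sign (p \<circ> t) = - sign p" using k
        by (simp add: t_def sign_compose permutation_swap_id sign_swap_id)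
      have "(\<Prod>i<Suc N. (if i = N then y k else y i) ^ (p \<circ> t) i) = (\<Prod>i<Suc N. (if t i = N then y k else y (t i)) ^ p (t i))"
        using k by (intro prod.cong) (auto simp: t_def Transposition.transpose_def)
      also have "\<dots> = (\<Prod>i<Suc N. (if i = N then y k else y i) ^ p i)"
        using prod.permute[OF tperm, of "\<lambda>i. (if i = N then y k else y i) ^ p i"] by (simp add: o_def)
      finally show "h (p \<circ> t) = - h p" unfolding h_def s by simp
    qed simp
    finally have "sum h V = - sum h V" by (simp add: sum_negf)
    then show ?thesis unfolding qh by (metis add.inverse_neutral eq_neg_iff_add_eq_0 double_zero mult_2 no_zero_divisors one_add_one zero_neq_numeral)
  qed
  ultimately have "q = smult (coeff q N) (\<Prod>i<N. [:- y i, 1:])"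
    using Suc.prems by (intro poly_eq_smult_prod_roots) (auto intro: inj_on_subset)
  then have "poly q (y N) = poly (smult (coeff q N) (\<Prod>i<N. [:- y i, 1:])) (y N)" by simp
  then have "poly q (y N) = coeff q N * (\<Prod>i<N. y N - y i)"
    by (simp add: poly_prod)
  moreover have "coeff q N = (\<Prod>j<N. \<Prod>i<j. y j - y i)"
  proof -
    have "coeff q N = (\<Sum>p\<in>V. if p N = N then c p else 0)"
      by (simp add: q_def coeff_sum if_distrib cong: if_cong)
    also have "\<dots> = sum c {p \<in> V. p N = N}"
      using finV by (simp add: sum.inter_filter)
    also have "{p \<in> V. p N = N} = {p. p permutes {..<N}}"
    proof -
      have "p permutes {..<N}" if "p permutes {..<Suc N}" "p N = N" for p
        using permutes_superset[OF that(1), of "{..<N}"] that(2) by (auto simp: less_Suc_eq)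
      moreover have "p permutes {..<Suc N} \<and> p N = N" if "p permutes {..<N}" for p
        using that permutes_subset[of p "{..<N}" "{..<Suc N}"] permutes_not_in[of p "{..<N}" N] by auto
      ultimately show ?thesis by (auto simp: V_def)
    qed
    also have "sum c {p. p permutes {..<N}} = (\<Prod>j<N. \<Prod>i<j. y j - y i)"
      unfolding c_def using Suc.prems by (intro Suc.IH) (auto intro: inj_on_subset)
    finally show ?thesis .
  qed
  ultimately show ?case by (simp add: pq V_def mult.assoc)
qed

section \<open>Expansion of the theta product\<close>

text \<open>Summability of complex families is absolute, so a finite product of such series can be
  multiplied out. Two notions of absolute summability are bridged: one yields summability of the
  product family, the other its value.\<close>

lemma has_sum_prod_PiE:
  fixes f :: "'a \<Rightarrow> 'b \<Rightarrow> complex"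
  assumes "finite A" "\<And>x. x \<in> A \<Longrightarrow> countable (B x)" "\<And>x. x \<in> A \<Longrightarrow> f x summable_on B x"
  shows "((\<lambda>g. \<Prod>x\<in>A. f x (g x)) has_sum (\<Prod>x\<in>A. infsum (f x) (B x))) (PiE A B)"
proof -
  have abs: "Infinite_Sum.abs_summable_on (f x) (B x)" if "x \<in> A" for x
    using assms(3)[OF that] summable_on_iff_abs_summable_on_complex by blast
  have "Infinite_Set_Sum.abs_summable_on (\<lambda>g. \<Prod>x\<in>A. f x (g x)) (PiE A B)"
    by (intro abs_summable_on_prod_PiE assms(1,2) abs_summable_equivalent[THEN iffD1] abs)
  then have "(\<lambda>g. \<Prod>x\<in>A. f x (g x)) summable_on PiE A B"
    by (metis abs_summable_equivalent abs_summable_summable)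
  then show ?thesis
    using infsum_prod_PiE_abs[OF assms(1), of f B, OF abs] by (simp add: has_sum_iff)
qed

lemma kronecker_m4_minus: "kronecker_m4 (- r) = - kronecker_m4 r"
  unfolding kronecker_m4_def by presburger

lemma kronecker_m4_even: "even r \<Longrightarrow> kronecker_m4 r = 0"
  unfolding kronecker_m4_def by presburger

text \<open>Adding 2 exchanges the classes 1 and 3 modulo 4 and keeps even numbers even. The
  resulting signs are what a lattice translation has to cancel.\<close>

lemma kronecker_m4_shift: "kronecker_m4 (r + 2 * d) = (if even d then kronecker_m4 r else - kronecker_m4 r)"
proof (cases "even d")
  case True
  then obtain e where "d = 2 * e" by blast
  then have "(r + 2 * d) mod 4 = r mod 4" by presburger
  with True show ?thesis by (simp add: kronecker_m4_def)
next
  case False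
  then obtain e where "d = 2 * e + 1" by (metis oddE)
  then have "(r + 2 * d) mod 4 = (r + 2) mod 4" by presburger
  then have "kronecker_m4 (r + 2 * d) = kronecker_m4 (r + 2)" by (simp add: kronecker_m4_def)
  also have "\<dots> = - kronecker_m4 r" unfolding kronecker_m4_def by presburger
  finally show ?thesis using False by simp
qed

definition theta_summand :: "complex \<Rightarrow> complex \<Rightarrow> int \<Rightarrow> complex" where
  "theta_summand \<tau> u r = of_int (kronecker_m4 r) * cpow \<tau> (of_int r ^ 2 / 8) * cpow u (of_int r / 2)"

lemma theta_summand_summable:
  assumes "Im \<tau> > 0"
  shows "theta_summand \<tau> u summable_on UNIV"
proof -
  have g: "(\<lambda>r::int. norm (cpow \<tau> (1/8 * of_int r ^ 2) * cpow (u / 2) (of_int r))) summable_on UNIV"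
    by (rule summable_on_iff_abs_summable_on_complex[THEN iffD1, OF gaussian_abs_summable[OF assms]]) simp
  have "cpow (u / 2) (of_int r) = cpow u (of_int r / 2)" for r
    by (simp add: cpow_def mult_ac)
  moreover have "\<bar>real_of_int (kronecker_m4 r)\<bar> \<le> 1" for r by (simp add: kronecker_m4_def)
  ultimately have "norm (theta_summand \<tau> u r) \<le> norm (cpow \<tau> (1/8 * of_int r ^ 2) * cpow (u / 2) (of_int r))" for r
    by (simp add: theta_summand_def norm_mult mult_right_le_one_le mult_left_le_one_le)
  then show ?thesis
    unfolding summable_on_iff_abs_summable_on_complex
    by (intro Infinite_Sum.abs_summable_on_comparison_test'[OF g])
qed

lemma jacobi_theta_eq_odd: "jacobi_theta \<tau> u = infsum (theta_summand \<tau> u) {r. odd r}"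
  unfolding jacobi_theta_def theta_summand_def[abs_def]
  by (rule infsum_cong_neutral) (auto simp: kronecker_m4_even)

text \<open>The summation indices of all theta factors at once, \<open>r i j\<close> with i < j
  belonging to the pair (i, j). Storing the negated copy below the diagonal makes row sums and
  simultaneous permutations of rows and columns uniform; zeros outside the range make the encoding
  unique.\<close>

definition odd_skew :: "nat \<Rightarrow> (nat \<Rightarrow> nat \<Rightarrow> int) set" where
  "odd_skew n = {r. (\<forall>i j. r j i = - r i j) \<and> (\<forall>i j. i \<le> n \<longrightarrow> j \<le> n \<longrightarrow> i \<noteq> j \<longrightarrow> odd (r i j)) \<and>
     (\<forall>i j. n < i \<or> n < j \<longrightarrow> r i j = 0)}"

definition skew_weight :: "nat \<Rightarrow> complex \<Rightarrow> (nat \<Rightarrow> nat \<Rightarrow> int) \<Rightarrow> complex" where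
  "skew_weight n \<tau> r = (\<Prod>(i, j)\<in>pairs n. of_int (kronecker_m4 (r i j)) * cpow \<tau> (of_int (r i j) ^ 2 / 8))"

text \<open>The exponent of e(u_i). For entries 1 and -1 the matrix is a tournament and this is the
  number of wins less n/2. The restriction matches the extensional vectors of
  \<open>index_vectors\<close>.\<close>

definition score :: "nat \<Rightarrow> (nat \<Rightarrow> nat \<Rightarrow> int) \<Rightarrow> nat \<Rightarrow> real" where
  "score n r = (\<lambda>i\<in>{0..n}. of_int (\<Sum>j=0..n. r i j) / 2)"

lemma odd_skewD:
  assumes "r \<in> odd_skew n"
  shows "r j i = - r i j" "i \<le> n \<Longrightarrow> j \<le> n \<Longrightarrow> i \<noteq> j \<Longrightarrow> odd (r i j)"
    "n < i \<or> n < j \<Longrightarrow> r i j = 0" "r i i = 0"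
proof -
  have *: "\<forall>i j. r j i = - r i j" using assms unfolding odd_skew_def by blast
  then show "r j i = - r i j" by blast
  have "r i i = - r i i" using * by blast
  then show "r i i = 0" by simp
qed (use assms in \<open>unfold odd_skew_def, blast+\<close>)

text \<open>By skew symmetry e((u_i - u_j) r_ij / 2) splits into e(u_i r_ij / 2) e(u_j r_ji / 2);
  regrouping by rows collects the half row sums. The diagonal is restored freely because it is
  zero.\<close>

lemma prod_theta_summand_eq:
  assumes "r \<in> odd_skew n"
  shows "(\<Prod>(i, j)\<in>pairs n. theta_summand \<tau> (u i - u j) (r i j)) =
    skew_weight n \<tau> r * (\<Prod>i=0..n. cpow (u i) (score n r i))"
proof -
  note skew = odd_skewD(1)[OF assms] and diag = odd_skewD(4)[OF assms]
  have "cpow (u i - u j) (of_int (r i j) / 2) = cpow (u i) (of_int (r i j) / 2) * cpow (u j) (of_int (r j i) / 2)" for i j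
    using cpow_add_left[of "u i" "- u j"] by (simp add: skew[of j i] cpow_minus)
  then have "(\<Prod>(i, j)\<in>pairs n. cpow (u i - u j) (of_int (r i j) / 2)) =
      (\<Prod>i=0..n. \<Prod>j\<in>{0..n} - {i}. cpow (u i) (of_int (r i j) / 2))"
    using prod.pairs_symmetrize[of "\<lambda>i j. cpow (u i) (of_int (r i j) / 2)" n] by simp
  also have "\<dots> = (\<Prod>i=0..n. cpow (u i) (score n r i))"
  proof (rule prod.cong)
    fix i assume i: "i \<in> {0..n}"
    have "(\<Prod>j\<in>{0..n} - {i}. cpow (u i) (of_int (r i j) / 2)) = (\<Prod>j=0..n. cpow (u i) (of_int (r i j) / 2))"
      using i by (subst prod.remove[of "{0..n}" i]) (simp_all add: diag)
    also have "\<dots> = cpow (u i) (score n r i)"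
      using i by (simp add: score_def sum_divide_distrib flip: cpow_sum)
    finally show "(\<Prod>j\<in>{0..n} - {i}. cpow (u i) (of_int (r i j) / 2)) = cpow (u i) (score n r i)" .
  qed simp
  finally show ?thesis
    by (simp add: skew_weight_def theta_summand_def case_prod_unfold prod.distrib)
qed

lemma theta_product_expansion:
  assumes "Im \<tau> > 0"
  shows "((\<lambda>r. skew_weight n \<tau> r * (\<Prod>i=0..n. cpow (u i) (score n r i))) has_sum
     (\<Prod>(i, j)\<in>pairs n. jacobi_theta \<tau> (u i - u j))) (odd_skew n)"
proof -
  have "((\<lambda>g. \<Prod>x\<in>pairs n. (case x of (i, j) \<Rightarrow> theta_summand \<tau> (u i - u j)) (g x)) has_sum
     (\<Prod>x\<in>pairs n. infsum (case x of (i, j) \<Rightarrow> theta_summand \<tau> (u i - u j)) {r. odd r})) (PiE (pairs n) (\<lambda>_. {r. odd r}))"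
    by (rule has_sum_prod_PiE)
      (auto intro: summable_on_subset_banach[OF theta_summand_summable[OF assms]] split: prod.split)
  also have "(\<Prod>x\<in>pairs n. infsum (case x of (i, j) \<Rightarrow> theta_summand \<tau> (u i - u j)) {r. odd r}) =
     (\<Prod>(i, j)\<in>pairs n. jacobi_theta \<tau> (u i - u j))"
    by (intro prod.cong) (auto simp: jacobi_theta_eq_odd)
  finally have *: "((\<lambda>g. \<Prod>x\<in>pairs n. (case x of (i, j) \<Rightarrow> theta_summand \<tau> (u i - u j)) (g x)) has_sum
     (\<Prod>(i, j)\<in>pairs n. jacobi_theta \<tau> (u i - u j))) (PiE (pairs n) (\<lambda>_. {r. odd r}))" .
  \<comment> \<open>\<open>to\<close> keeps the entries above the diagonal and \<open>fro\<close>
    restores the others by skew symmetry; so skew matrices correspond to families with one odd index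
    for each theta factor.\<close>
  define to where "to r = (\<lambda>(i, j)\<in>pairs n. r i j)" for r :: "nat \<Rightarrow> nat \<Rightarrow> int"
  define fro where "fro g i j = (if (i, j) \<in> pairs n then g (i, j) else if (j, i) \<in> pairs n then - g (j, i) else 0)"
    for g :: "nat \<times> nat \<Rightarrow> int" and i j
  have nswap: "(j, i) \<notin> pairs n" if "(i, j) \<in> pairs n" for i j using that by (auto simp: pairs_def)
  show ?thesis
  proof (subst has_sum_reindex_bij_witness[where i = fro and j = to])
    fix r assume r: "r \<in> odd_skew n"
    note r' = odd_skewD[OF r]
    show "fro (to r) = r"
    proof (intro ext)
      fix i j
      show "fro (to r) i j = r i j"
        using r'(1)[of i j] r'(3)[of i j] r'(4)[of i]
        by (cases i j rule: linorder_cases) (auto simp: fro_def to_def pairs_def)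
    qed
    show "to r \<in> PiE (pairs n) (\<lambda>_. {r. odd r})"
      using r'(2) by (auto simp: to_def pairs_def)
    show "(\<Prod>x\<in>pairs n. (case x of (i, j) \<Rightarrow> theta_summand \<tau> (u i - u j)) (to r x)) =
       skew_weight n \<tau> r * (\<Prod>i=0..n. cpow (u i) (score n r i))"
      unfolding prod_theta_summand_eq[OF r, symmetric] by (rule prod.cong) (auto simp: to_def)
  next
    fix g :: "nat \<times> nat \<Rightarrow> int" assume g: "g \<in> PiE (pairs n) (\<lambda>_. {r. odd r})"
    show "to (fro g) = g"
      using g by (auto simp: to_def fro_def PiE_def extensional_def fun_eq_iff restrict_def)
    have godd: "odd (g (i, j))" if "(i, j) \<in> pairs n" for i j
      using g that by (auto simp: PiE_def Pi_def)
    show "fro g \<in> odd_skew n"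
      unfolding odd_skew_def
    proof (intro CollectI conjI allI impI)
      fix i j show "fro g j i = - fro g i j" by (simp add: fro_def nswap)
      show "fro g i j = 0" if "n < i \<or> n < j" using that by (auto simp: fro_def pairs_def)
      show "odd (fro g i j)" if "i \<le> n" "j \<le> n" "i \<noteq> j"
        using that godd[of i j] godd[of j i] by (cases i j rule: linorder_cases) (auto simp: fro_def pairs_def)
    qed
  qed (use * in simp_all)
qed

lemma index_vectorsI:
  assumes "\<And>i. i \<le> n \<Longrightarrow> \<exists>k::int. x i = real n / 2 + of_int k" "\<And>i. n < i \<Longrightarrow> x i = undefined"
    "(\<Sum>i=0..n. x i) = 0"
  shows "x \<in> index_vectors n"
  using assms unfolding index_vectors_def by (fastforce simp: PiE_def extensional_def)

lemma index_vectorsD: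
  assumes "x \<in> index_vectors n"
  shows "i \<le> n \<Longrightarrow> \<exists>k::int. x i = real n / 2 + of_int k" "n < i \<Longrightarrow> x i = undefined"
    "(\<Sum>i=0..n. x i) = 0"
  using assms unfolding index_vectors_def by (fastforce simp: PiE_def extensional_def)+

text \<open>A row has n odd entries off the diagonal, so its sum has the parity of n; over the whole
  matrix the entries cancel by skew symmetry.\<close>

lemma score_in_index_vectors:
  assumes "r \<in> odd_skew n"
  shows "score n r \<in> index_vectors n"
proof (rule index_vectorsI)
  note r' = odd_skewD[OF assms]
  fix i assume i: "i \<le> n"
  have "even (\<Sum>j\<in>{0..n} - {i}. r i j - 1)"
    using r'(2) i by (intro dvd_sum) auto
  also have "(\<Sum>j\<in>{0..n} - {i}. r i j - 1) = (\<Sum>j=0..n. r i j) - int n"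
    using i by (simp add: sum_subtractf sum.remove[of "{0..n}" i] r'(4))
  finally obtain k where "(\<Sum>j=0..n. r i j) - int n = 2 * k" by blast
  then have eq: "(\<Sum>j=0..n. r i j) = int n + 2 * k" by simp
  have "score n r i = of_int (\<Sum>j=0..n. r i j) / 2" using i by (simp add: score_def)
  then have "score n r i = real n / 2 + of_int k" unfolding eq by (simp add: add_divide_distrib)
  then show "\<exists>k::int. score n r i = real n / 2 + of_int k" by blast
next
  have "(\<Sum>i=0..n. \<Sum>j=0..n. r i j) = (\<Sum>i=0..n. \<Sum>j=0..n. r j i)" by (rule sum.swap)
  also have "\<dots> = (\<Sum>i=0..n. \<Sum>j=0..n. - r i j)"
    by (intro sum.cong refl odd_skewD(1)[OF assms])
  also have "\<dots> = - (\<Sum>i=0..n. \<Sum>j=0..n. r i j)" by (simp add: sum_negf)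
  finally have z: "(\<Sum>i=0..n. \<Sum>j=0..n. r i j) = 0" by simp
  have "(\<Sum>i=0..n. score n r i) = of_int (\<Sum>i=0..n. \<Sum>j=0..n. r i j) / 2"
    by (simp add: score_def sum_divide_distrib)
  then show "(\<Sum>i=0..n. score n r i) = 0" by (simp only: z)
qed (simp add: score_def)

definition theta_coeff :: "nat \<Rightarrow> complex \<Rightarrow> (nat \<Rightarrow> real) \<Rightarrow> complex" where
  "theta_coeff n \<tau> x = infsum (skew_weight n \<tau>) {r \<in> odd_skew n. score n r = x}"

lemma theta_product_has_sum:
  assumes "Im \<tau> > 0"
  shows "((\<lambda>x. theta_coeff n \<tau> x * (\<Prod>i=0..n. cpow (u i) (x i))) has_sum
     (\<Prod>(i, j)\<in>pairs n. jacobi_theta \<tau> (u i - u j))) (index_vectors n)"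
proof -
  define B where "B x = {r \<in> odd_skew n. score n r = x}" for x
  define h where "h r = skew_weight n \<tau> r * (\<Prod>i=0..n. cpow (u i) (score n r i))" for r
  \<comment> \<open>At u = 0 all exponentials are 1, so the expansion yields summability of the bare
    weights.\<close>
  have ws: "skew_weight n \<tau> summable_on odd_skew n"
    using theta_product_expansion[OF assms, of n "\<lambda>_. 0"] by (auto dest: has_sum_imp_summable)
  show ?thesis
  proof (rule has_sum_SigmaD[where f = "\<lambda>(x, r). h r" and B = B])
    have "(h has_sum (\<Prod>(i, j)\<in>pairs n. jacobi_theta \<tau> (u i - u j))) (odd_skew n)"
      unfolding h_def by (rule theta_product_expansion[OF assms])
    also have "?this \<longleftrightarrow> ((\<lambda>(x, r). h r) has_sum (\<Prod>(i, j)\<in>pairs n. jacobi_theta \<tau> (u i - u j))) (Sigma (index_vectors n) B)"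
      by (rule has_sum_reindex_bij_witness[where i = snd and j = "\<lambda>r. (score n r, r)"])
        (auto simp: B_def score_in_index_vectors)
    finally show "((\<lambda>(x, r). h r) has_sum (\<Prod>(i, j)\<in>pairs n. jacobi_theta \<tau> (u i - u j))) (Sigma (index_vectors n) B)" .
  next
    fix x
    have "(skew_weight n \<tau> has_sum theta_coeff n \<tau> x) (B x)"
      unfolding theta_coeff_def B_def[symmetric]
      by (intro has_sum_infsum summable_on_subset_banach[OF ws]) (auto simp: B_def)
    then have "((\<lambda>r. skew_weight n \<tau> r * (\<Prod>i=0..n. cpow (u i) (x i))) has_sum
        theta_coeff n \<tau> x * (\<Prod>i=0..n. cpow (u i) (x i))) (B x)"
      by (rule has_sum_cmult_left)
    then show "((\<lambda>r. case (x, r) of (x, r) \<Rightarrow> h r) has_sum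
        theta_coeff n \<tau> x * (\<Prod>i=0..n. cpow (u i) (x i))) (B x)"
      by (rule has_sum_cong[THEN iffD1, rotated]) (auto simp: h_def B_def)
  qed
qed

text \<open>The factor of a pair is odd in its entry: the character is odd, the Gaussian
  even.\<close>

lemma skew_weight_permute:
  assumes "p permutes {0..n}" "r \<in> odd_skew n"
  shows "skew_weight n \<tau> (\<lambda>i j. r (p i) (p j)) = of_int (sign p) * skew_weight n \<tau> r"
  unfolding skew_weight_def
  using prod_pairs_permute[OF assms(1), of "\<lambda>i j. of_int (kronecker_m4 (r i j)) * cpow \<tau> (of_int (r i j) ^ 2 / 8)"]
    odd_skewD(1)[OF assms(2)]
  by (metis (no_types, lifting) kronecker_m4_minus mult_minus_left of_int_minus power2_minus)

text \<open>Permuting rows and columns simultaneously is a bijection from the matrices with score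
  \<open>x\<close> to those with score \<open>x \<circ> p\<close>, and it multiplies every weight by
  the same sign.\<close>

lemma theta_coeff_permute:
  assumes p: "p permutes {0..n}"
  shows "theta_coeff n \<tau> (x \<circ> p) = of_int (sign p) * theta_coeff n \<tau> x"
proof -
  have ip: "inv p permutes {0..n}" by (rule permutes_inv[OF p])
  have sc: "score n (\<lambda>i j. r (p i) (p j)) = score n r \<circ> p" if "p permutes {0..n}" for r p
  proof
    fix i
    have "(\<Sum>j=0..n. r (p i) (p j)) = (\<Sum>j=0..n. r (p i) j)"
      using sum.permute[OF that, of "r (p i)"] by (simp add: o_def)
    then have "real_of_int (\<Sum>j=0..n. r (p i) (p j)) = of_int (\<Sum>j=0..n. r (p i) j)" by (rule arg_cong)
    moreover have "p i \<le> n \<longleftrightarrow> i \<le> n" using permutes_in_image[OF that, of i] by simp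
    ultimately show "score n (\<lambda>i j. r (p i) (p j)) i = (score n r \<circ> p) i"
      by (simp add: score_def)
  qed
  have mem: "(\<lambda>i j. r (p i) (p j)) \<in> odd_skew n" if p: "p permutes {0..n}" and r: "r \<in> odd_skew n" for r p
    unfolding odd_skew_def
  proof (intro CollectI conjI allI impI)
    have pin: "p i \<le> n \<longleftrightarrow> i \<le> n" for i using permutes_in_image[OF p, of i] by simp
    fix i j
    show "r (p j) (p i) = - r (p i) (p j)" by (rule odd_skewD(1)[OF r])
    show "odd (r (p i) (p j))" if "i \<le> n" "j \<le> n" "i \<noteq> j"
      using that pin permutes_inj[OF p] by (intro odd_skewD(2)[OF r]) (auto dest: injD)
    show "r (p i) (p j) = 0" if "n < i \<or> n < j"
      using that pin[of i] pin[of j] by (intro odd_skewD(3)[OF r]) linarith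
  qed
  have "theta_coeff n \<tau> (x \<circ> p) = infsum (\<lambda>r. of_int (sign p) * skew_weight n \<tau> r) {r \<in> odd_skew n. score n r = x}"
    unfolding theta_coeff_def
  proof (rule infsum_reindex_bij_witness[where i = "\<lambda>r i j. r (p i) (p j)" and j = "\<lambda>r i j. r (inv p i) (inv p j)", symmetric, THEN sym])
    fix r assume r: "r \<in> {r \<in> odd_skew n. score n r = x \<circ> p}"
    show "(\<lambda>i j. r (inv p (p i)) (inv p (p j))) = r" using permutes_inverses[OF p] by simp
    have "score n r \<circ> inv p = x" using r permutes_inv_o[OF p] by (simp add: o_assoc[symmetric])
    then show 1: "(\<lambda>i j. r (inv p i) (inv p j)) \<in> {r \<in> odd_skew n. score n r = x}"
      using mem[OF ip] sc[OF ip] r by simp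
    then show "of_int (sign p) * skew_weight n \<tau> (\<lambda>i j. r (inv p i) (inv p j)) = skew_weight n \<tau> r"
      using skew_weight_permute[OF p, of "\<lambda>i j. r (inv p i) (inv p j)" \<tau>] permutes_inverses[OF p] by simp
  next
    fix r assume r: "r \<in> {r \<in> odd_skew n. score n r = x}"
    show "(\<lambda>i j. r (p (inv p i)) (p (inv p j))) = r" using permutes_inverses[OF p] by simp
    show "(\<lambda>i j. r (p i) (p j)) \<in> {r \<in> odd_skew n. score n r = x \<circ> p}"
      using mem[OF p] sc[OF p] r by simp
  qed
  then show ?thesis by (simp add: theta_coeff_def infsum_cmult_right')
qed

section \<open>Translation by the root lattice\<close>

definition shift_by :: "nat \<Rightarrow> (nat \<Rightarrow> int) \<Rightarrow> (nat \<Rightarrow> real) \<Rightarrow> nat \<Rightarrow> real" where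
  "shift_by n k x = (\<lambda>i\<in>{0..n}. x i + of_int (k i) * real (n + 1))"

definition energy :: "nat \<Rightarrow> (nat \<Rightarrow> real) \<Rightarrow> real" where
  "energy n x = (\<Sum>i=0..n. x i ^ 2) / (2 * real (n + 1))"

definition skew_shift :: "nat \<Rightarrow> (nat \<Rightarrow> int) \<Rightarrow> (nat \<Rightarrow> nat \<Rightarrow> int) \<Rightarrow> nat \<Rightarrow> nat \<Rightarrow> int" where
  "skew_shift n k r i j = (if i \<le> n \<and> j \<le> n then r i j + 2 * (k i - k j) else 0)"

lemma skew_shift_in: "r \<in> odd_skew n \<Longrightarrow> skew_shift n k r \<in> odd_skew n"
  unfolding odd_skew_def
proof (intro CollectI conjI allI impI)
  fix i j assume "r \<in> {r. (\<forall>i j. r j i = - r i j) \<and> (\<forall>i j. i \<le> n \<longrightarrow> j \<le> n \<longrightarrow> i \<noteq> j \<longrightarrow> odd (r i j)) \<and>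
     (\<forall>i j. n < i \<or> n < j \<longrightarrow> r i j = 0)}"
  then have r: "r \<in> odd_skew n" unfolding odd_skew_def .
  show "skew_shift n k r j i = - skew_shift n k r i j"
    using odd_skewD(1)[OF r, of j i] by (simp add: skew_shift_def)
  show "odd (skew_shift n k r i j)" if "i \<le> n" "j \<le> n" "i \<noteq> j"
    using that odd_skewD(2)[OF r, of i j] by (simp add: skew_shift_def)
  show "skew_shift n k r i j = 0" if "n < i \<or> n < j"
    using that by (auto simp: skew_shift_def)
qed

text \<open>Row i grows by 2 (N k_i - sum k); the vanishing of sum k makes this, after halving, a
  translation by N k_i.\<close>

lemma score_skew_shift:
  assumes "(\<Sum>i=0..n. k i) = 0"
  shows "score n (skew_shift n k r) = shift_by n k (score n r)"
proof
  fix i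
  show "score n (skew_shift n k r) i = shift_by n k (score n r) i"
  proof (cases "i \<le> n")
    case True
    then have "(\<Sum>j=0..n. skew_shift n k r i j) = (\<Sum>j=0..n. r i j) + 2 * (int (n + 1) * k i - (\<Sum>j=0..n. k j))"
      by (simp add: skew_shift_def sum.distrib sum_subtractf flip: sum_distrib_left)
    then have "(\<Sum>j=0..n. skew_shift n k r i j) = (\<Sum>j=0..n. r i j) + 2 * (int (n + 1) * k i)"
      using assms by simp
    then have "real_of_int (\<Sum>j=0..n. skew_shift n k r i j) = of_int ((\<Sum>j=0..n. r i j) + 2 * (int (n + 1) * k i))"
      by (rule arg_cong)
    moreover have "score n (skew_shift n k r) i = of_int (\<Sum>j=0..n. skew_shift n k r i j) / 2"
      using True by (simp add: score_def)
    ultimately have "score n (skew_shift n k r) i = of_int ((\<Sum>j=0..n. r i j) + 2 * (int (n + 1) * k i)) / 2"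
      by simp
    then show ?thesis using True by (simp add: score_def shift_by_def add_divide_distrib mult.commute)
  qed (simp add: score_def shift_by_def)
qed

lemma energy_shift_by:
  "energy n (shift_by n k x) - energy n x = (\<Sum>i=0..n. x i * of_int (k i)) + real (n + 1) / 2 * (\<Sum>i=0..n. of_int (k i) ^ 2)"
proof -
  have eq: "(\<Sum>i=0..n. shift_by n k x i ^ 2) = (\<Sum>i=0..n. x i ^ 2) + 2 * real (n + 1) * (\<Sum>i=0..n. x i * of_int (k i)) + real (n + 1) ^ 2 * (\<Sum>i=0..n. of_int (k i) ^ 2)"
    by (simp add: shift_by_def sum_distrib_left power2_eq_square algebra_simps flip: sum.distrib)
  have alg: "(S + 2 * N * a + N ^ 2 * b) / (2 * N) - S / (2 * N) = a + N / 2 * b" if "N \<noteq> 0" for S N a b :: real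
    using that by (simp add: power2_eq_square field_simps)
  show ?thesis unfolding energy_def eq by (rule alg) simp
qed

text \<open>The character contributes (-1)^(k_i - k_j) for each pair; every index lies in n pairs,
  so the total is a power of (-1)^(sum k) = 1. The Gaussian exponents grow by a sum over pairs
  which, because sum k = 0, depends on \<open>r\<close> only through its score and is the change of
  energy.\<close>

lemma skew_weight_shift:
  assumes k: "(\<Sum>i=0..n. k i) = 0" and r: "r \<in> odd_skew n"
  shows "skew_weight n \<tau> (skew_shift n k r) =
    cpow \<tau> (energy n (shift_by n k (score n r)) - energy n (score n r)) * skew_weight n \<tau> r"
proof -
  define \<epsilon> where "\<epsilon> d = (if even d then 1 else - 1 :: complex)" for d :: int
  have \<epsilon>_add: "\<epsilon> (a + b) = \<epsilon> a * \<epsilon> b" for a b by (simp add: \<epsilon>_def)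
  have \<epsilon>_sum: "\<epsilon> (sum k A) = (\<Prod>i\<in>A. \<epsilon> (k i))" if "finite A" for A
    using that by (induction A rule: finite_induct) (simp_all add: \<epsilon>_add, simp add: \<epsilon>_def)
  note skew = odd_skewD(1)[OF r] and diag = odd_skewD(4)[OF r]
  have factor: "of_int (kronecker_m4 (skew_shift n k r i j)) * cpow \<tau> (of_int (skew_shift n k r i j) ^ 2 / 8) =
     (of_int (kronecker_m4 (r i j)) * cpow \<tau> (of_int (r i j) ^ 2 / 8)) *
     (\<epsilon> (k i) * \<epsilon> (k j)) * cpow \<tau> ((of_int (r i j) * (of_int (k i) - of_int (k j)) + (of_int (k i) - of_int (k j))^2) / 2)"
    if ij: "(i, j) \<in> pairs n" for i j
  proof -
    have s: "skew_shift n k r i j = r i j + 2 * (k i - k j)" using ij by (auto simp: skew_shift_def pairs_def)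
    have "of_int (kronecker_m4 (skew_shift n k r i j)) = of_int (kronecker_m4 (r i j)) * (\<epsilon> (k i) * \<epsilon> (k j))"
      unfolding s kronecker_m4_shift by (simp add: \<epsilon>_def)
    moreover have "real_of_int (skew_shift n k r i j) ^ 2 / 8 = of_int (r i j) ^ 2 / 8 +
      (of_int (r i j) * (of_int (k i) - of_int (k j)) + (of_int (k i) - of_int (k j))^2) / 2"
      unfolding s by (simp add: power2_eq_square field_simps)
    ultimately show ?thesis by (simp only: cpow_add mult_ac)
  qed
  have signs: "(\<Prod>(i, j)\<in>pairs n. \<epsilon> (k i) * \<epsilon> (k j)) = 1"
  proof -
    have "(\<Prod>(i, j)\<in>pairs n. \<epsilon> (k i) * \<epsilon> (k j)) = (\<Prod>i=0..n. \<epsilon> (k i)) ^ n"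
      unfolding prod.pairs_symmetrize[of "\<lambda>i j. \<epsilon> (k i)"] by (simp add: prod_power_distrib)
    also have "(\<Prod>i=0..n. \<epsilon> (k i)) = 1" using \<epsilon>_sum[of "{0..n}"] k by (simp add: \<epsilon>_def)
    finally show ?thesis by simp
  qed
  define K where "K i = real_of_int (k i)" for i
  define R where "R i j = real_of_int (r i j)" for i j
  have K0: "(\<Sum>i=0..n. K i) = 0" using k by (simp add: K_def flip: of_int_sum)
  have Rs: "R j i = - R i j" "R i i = 0" for i j using skew[of j i] diag by (simp_all add: R_def)
  \<comment> \<open>Each term is written as an expression in (i, j) plus the same expression in (j,
    i), ready for regrouping by rows. In row i the cross terms then add up to a multiple of sum K,
    which is 0.\<close>
  have "(\<Sum>(i, j)\<in>pairs n. (R i j * (K i - K j) + (K i - K j)^2) / 2) =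
     (\<Sum>(i, j)\<in>pairs n. (R i j * K i / 2 + (K i ^ 2 - K i * K j) / 2) + (R j i * K j / 2 + (K j ^ 2 - K j * K i) / 2))"
  proof (rule sum.cong; clarify)
    fix i j
    show "(R i j * (K i - K j) + (K i - K j)^2) / 2 =
      (R i j * K i / 2 + (K i ^ 2 - K i * K j) / 2) + (R j i * K j / 2 + (K j ^ 2 - K j * K i) / 2)"
      unfolding Rs(1)[of j i] by (simp add: power2_eq_square field_simps)
  qed
  also have "\<dots> = (\<Sum>i=0..n. \<Sum>j\<in>{0..n} - {i}. R i j * K i / 2 + (K i ^ 2 - K i * K j) / 2)"
    by (rule sum.pairs_symmetrize)
  also have "\<dots> = (\<Sum>i=0..n. \<Sum>j=0..n. R i j * K i / 2 + (K i ^ 2 - K i * K j) / 2)"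
  proof (rule sum.cong)
    fix i assume "i \<in> {0..n}"
    then show "(\<Sum>j\<in>{0..n} - {i}. R i j * K i / 2 + (K i ^ 2 - K i * K j) / 2) = (\<Sum>j=0..n. R i j * K i / 2 + (K i ^ 2 - K i * K j) / 2)"
      by (subst sum.remove[of "{0..n}" i]) (simp_all add: Rs(2) power2_eq_square)
  qed simp
  also have "\<dots> = (\<Sum>i=0..n. (\<Sum>j=0..n. R i j) / 2 * K i + real (n + 1) / 2 * K i ^ 2)"
  proof (rule sum.cong)
    fix i
    have "(\<Sum>j=0..n. R i j * K i / 2 + (K i ^ 2 - K i * K j) / 2) =
      (\<Sum>j=0..n. R i j) / 2 * K i + (real (n + 1) * K i ^ 2 - K i * (\<Sum>j=0..n. K j)) / 2"
      by (simp add: sum.distrib sum_subtractf sum_distrib_left sum_distrib_right sum_divide_distrib diff_divide_distrib)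
    then show "(\<Sum>j=0..n. R i j * K i / 2 + (K i ^ 2 - K i * K j) / 2) = (\<Sum>j=0..n. R i j) / 2 * K i + real (n + 1) / 2 * K i ^ 2"
      by (simp add: K0)
  qed simp
  also have "\<dots> = energy n (shift_by n k (score n r)) - energy n (score n r)"
    unfolding energy_shift_by by (simp add: score_def K_def R_def sum.distrib sum_distrib_left)
  finally have ex: "(\<Sum>(i, j)\<in>pairs n. (R i j * (K i - K j) + (K i - K j)^2) / 2) =
     energy n (shift_by n k (score n r)) - energy n (score n r)" .
  have "skew_weight n \<tau> (skew_shift n k r) = (\<Prod>(i, j)\<in>pairs n. (of_int (kronecker_m4 (r i j)) * cpow \<tau> (of_int (r i j) ^ 2 / 8)) *
     (\<epsilon> (k i) * \<epsilon> (k j)) * cpow \<tau> ((R i j * (K i - K j) + (K i - K j)^2) / 2))"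
    unfolding skew_weight_def R_def K_def by (rule prod.cong; clarify; rule factor)
  also have "\<dots> = skew_weight n \<tau> r * (\<Prod>(i, j)\<in>pairs n. \<epsilon> (k i) * \<epsilon> (k j)) *
     (\<Prod>(i, j)\<in>pairs n. cpow \<tau> ((R i j * (K i - K j) + (K i - K j)^2) / 2))"
    by (simp add: skew_weight_def case_prod_unfold prod.distrib)
  also have "(\<Prod>(i, j)\<in>pairs n. cpow \<tau> ((R i j * (K i - K j) + (K i - K j)^2) / 2)) =
     cpow \<tau> (energy n (shift_by n k (score n r)) - energy n (score n r))"
    unfolding ex[symmetric] cpow_sum by (simp add: case_prod_unfold)
  finally show ?thesis unfolding signs by simp
qed

lemma theta_coeff_shift:
  assumes k: "(\<Sum>i=0..n. k i) = 0" and x: "x \<in> index_vectors n"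
  shows "theta_coeff n \<tau> (shift_by n k x) = cpow \<tau> (energy n (shift_by n k x) - energy n x) * theta_coeff n \<tau> x"
proof -
  have k': "(\<Sum>i=0..n. - k i) = 0" using k by (simp add: sum_negf)
  have inv: "shift_by n (\<lambda>i. - k i) (shift_by n k y) = y" if "y \<in> index_vectors n" for y k
    using index_vectorsD(2)[OF that] by (auto simp: shift_by_def fun_eq_iff)
  have sinv: "skew_shift n (\<lambda>i. - k i) (skew_shift n k r) = r" if "r \<in> odd_skew n" for r k
    using odd_skewD(3)[OF that] by (auto simp: skew_shift_def fun_eq_iff not_le)
  have "theta_coeff n \<tau> (shift_by n k x) =
    infsum (\<lambda>r. cpow \<tau> (energy n (shift_by n k x) - energy n x) * skew_weight n \<tau> r) {r \<in> odd_skew n. score n r = x}"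
    unfolding theta_coeff_def
  proof (rule infsum_reindex_bij_witness[where i = "skew_shift n k" and j = "skew_shift n (\<lambda>i. - k i)"])
    fix r assume "r \<in> {r \<in> odd_skew n. score n r = shift_by n k x}"
    then have r: "r \<in> odd_skew n" "score n r = shift_by n k x" by auto
    show 1: "skew_shift n k (skew_shift n (\<lambda>i. - k i) r) = r" using sinv[OF r(1), of "\<lambda>i. - k i"] by simp
    show 2: "skew_shift n (\<lambda>i. - k i) r \<in> {r \<in> odd_skew n. score n r = x}"
      using skew_shift_in[OF r(1)] score_skew_shift[OF k'] r(2) inv[OF x] by simp
    then show "cpow \<tau> (energy n (shift_by n k x) - energy n x) * skew_weight n \<tau> (skew_shift n (\<lambda>i. - k i) r) = skew_weight n \<tau> r"
      using skew_weight_shift[OF k, of "skew_shift n (\<lambda>i. - k i) r" \<tau>] 1 by simp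
  next
    fix r assume r: "r \<in> {r \<in> odd_skew n. score n r = x}"
    then show "skew_shift n (\<lambda>i. - k i) (skew_shift n k r) = r" using sinv by blast
    show "skew_shift n k r \<in> {r \<in> odd_skew n. score n r = shift_by n k x}"
      using r skew_shift_in score_skew_shift[OF k] by auto
  qed
  then show ?thesis by (simp add: theta_coeff_def infsum_cmult_right')
qed

text \<open>A Weyl vector of type A_n, for the ordering in which its coordinates increase. It
  belongs to the identity permutation, so its sign is 1.\<close>

definition weyl_vector :: "nat \<Rightarrow> nat \<Rightarrow> real" where
  "weyl_vector n = (\<lambda>i\<in>{0..n}. - real n / 2 + real i)"

lemma sum_weyl_vector: "(\<Sum>i=0..n. - real n / 2 + real i) = 0"
proof -
  have "(\<Sum>i=0..n. real i) = real n * (real n + 1) / 2"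
    by (induction n) (simp_all add: field_simps)
  moreover have "(\<Sum>i=0..n. - real n / 2 + real i) = real (n + 1) * (- real n / 2) + (\<Sum>i=0..n. real i)"
    by (subst sum.distrib) simp
  ultimately show ?thesis by (simp add: field_simps)
qed

lemma weyl_vector_in: "weyl_vector n \<in> index_vectors n"
proof (rule index_vectorsI)
  fix i assume "i \<le> n"
  then have "weyl_vector n i = real n / 2 + of_int (int i - int n)"
    by (simp add: weyl_vector_def field_simps)
  then show "\<exists>k::int. weyl_vector n i = real n / 2 + of_int k" by blast
qed (use sum_weyl_vector in \<open>simp_all add: weyl_vector_def\<close>)

lemma index_vectors_permute:
  assumes "p permutes {0..n}" "x \<in> index_vectors n"
  shows "x \<circ> p \<in> index_vectors n"
proof (rule index_vectorsI)
  have pin: "p i \<le> n \<longleftrightarrow> i \<le> n" for i using permutes_in_image[OF assms(1), of i] by simp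
  show "\<exists>k::int. (x \<circ> p) i = real n / 2 + of_int k" if "i \<le> n" for i
    using index_vectorsD(1)[OF assms(2), of "p i"] pin that by simp
  show "(x \<circ> p) i = undefined" if "n < i" for i
    using index_vectorsD(2)[OF assms(2), of "p i"] pin[of i] that by simp
  show "(\<Sum>i=0..n. (x \<circ> p) i) = 0"
    using sum.permute[OF assms(1), of x] index_vectorsD(3)[OF assms(2)] by (simp add: o_def)
qed

lemma energy_permute: "p permutes {0..n} \<Longrightarrow> energy n (x \<circ> p) = energy n x"
  using sum.permute[of p "{0..n}" "\<lambda>i. x i ^ 2"] by (simp add: energy_def o_def)

text \<open>The translation lies in the root lattice automatically: \<open>x\<close> and the
  permuted Weyl vector both have coordinate sum 0, so N times sum k is 0. Extensionality of
  \<open>k\<close> is recorded because the pairs (p, k) later parametrize the vectors.\<close>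

lemma perm_congruent_decompose:
  assumes x: "x \<in> index_vectors n" and p: "perm_congruent n x p"
  obtains k where "(\<Sum>i=0..n. k i) = 0" "x = shift_by n k (weyl_vector n \<circ> p)" "k \<in> {0..n} \<rightarrow>\<^sub>E UNIV"
proof -
  from p obtain k0 where k0: "\<And>i. i \<le> n \<Longrightarrow> x i = - real n / 2 + real (p i) + of_int (k0 i :: int) * real (n + 1)"
    and perm: "p permutes {0..n}"
    unfolding perm_congruent_def by metis
  define k where "k = (\<lambda>i\<in>{0..n}. k0 i)"
  have pin: "p i \<le> n \<longleftrightarrow> i \<le> n" for i using permutes_in_image[OF perm, of i] by simp
  have xs: "x = shift_by n k (weyl_vector n \<circ> p)"
  proof
    fix i
    show "x i = shift_by n k (weyl_vector n \<circ> p) i"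
      using k0[of i] index_vectorsD(2)[OF x, of i] pin[of i]
      by (cases "i \<le> n") (simp_all add: shift_by_def weyl_vector_def k_def)
  qed
  have "0 = (\<Sum>i=0..n. x i)" using index_vectorsD(3)[OF x] by simp
  also have "\<dots> = (\<Sum>i=0..n. (weyl_vector n \<circ> p) i) + real (n + 1) * (\<Sum>i=0..n. of_int (k i))"
    unfolding xs by (simp add: shift_by_def sum.distrib sum_distrib_left mult.commute)
  also have "(\<Sum>i=0..n. (weyl_vector n \<circ> p) i) = 0"
    using index_vectors_permute[OF perm weyl_vector_in] by (rule index_vectorsD(3))
  finally have "real_of_int (\<Sum>i=0..n. k i) = 0" by simp
  then have "(\<Sum>i=0..n. k i) = 0" by (simp only: of_int_eq_0_iff)
  then show ?thesis using xs by (rule that) (simp add: k_def)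
qed

lemma theta_coeff_perm_congruent:
  assumes x: "x \<in> index_vectors n" and p: "perm_congruent n x p"
  shows "theta_coeff n \<tau> x = of_int (sign p) * cpow \<tau> (energy n x - energy n (weyl_vector n)) * theta_coeff n \<tau> (weyl_vector n)"
proof -
  obtain k where k: "(\<Sum>i=0..n. k i) = 0" "x = shift_by n k (weyl_vector n \<circ> p)"
    using perm_congruent_decompose[OF assms] by blast
  have perm: "p permutes {0..n}" using p by (simp add: perm_congruent_def)
  show ?thesis
    unfolding k(2) theta_coeff_shift[OF k(1) index_vectors_permute[OF perm weyl_vector_in]]
      energy_permute[OF perm, of "weyl_vector n"] theta_coeff_permute[OF perm] by simp
qed

text \<open>Pigeonhole: the residues of x_i + n/2 modulo N lie in {0..n}, and if they were distinct
  they would form a permutation congruent to \<open>x\<close>.\<close>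

lemma not_perm_congruent_collision:
  assumes x: "x \<in> index_vectors n" and "\<nexists>p. perm_congruent n x p"
  obtains i j d where "i < j" "j \<le> n" "x i = x j + of_int (d :: int) * real (n + 1)"
proof -
  from index_vectorsD(1)[OF x] obtain m where m: "\<And>i. i \<le> n \<Longrightarrow> x i = real n / 2 + of_int (m i :: int)"
    by metis
  \<comment> \<open>The residue of x_i + n/2 = m_i + n; outside {0..n} it is the identity, as
    \<open>permutes\<close> demands.\<close>
  define p where "p i = (if i \<le> n then nat ((m i + int n) mod int (n + 1)) else i)" for i
  have p_int: "int (p i) = (m i + int n) mod int (n + 1)" if "i \<le> n" for i
    using that by (simp add: p_def del: of_nat_Suc of_nat_add)
  have p_le: "p i \<le> n" if "i \<le> n" for i
  proof -
    have "int (p i) < int (n + 1)" unfolding p_int[OF that] by (rule pos_mod_bound) simp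
    then show ?thesis by simp
  qed
  have "\<not> inj_on p {0..n}"
  proof
    assume inj: "inj_on p {0..n}"
    have "p ` {0..n} \<subseteq> {0..n}"
    proof (rule image_subsetI)
      fix i assume "i \<in> {0..n}"
      then show "p i \<in> {0..n}" using p_le[of i] by simp
    qed
    then have "p ` {0..n} = {0..n}" by (rule endo_inj_surj[OF finite_atLeastAtMost _ inj])
    with inj have "bij_betw p {0..n} {0..n}" by (simp add: bij_betw_def)
    then have "p permutes {0..n}" by (rule bij_imp_permutes) (simp add: p_def)
    moreover have "\<exists>k::int. x i = - real n / 2 + real (p i) + of_int k * real (n + 1)" if "i \<le> n" for i
    proof
      have "m i + int n = int (p i) + ((m i + int n) div int (n + 1)) * int (n + 1)"
        unfolding p_int[OF that] by (rule mod_div_mult_eq[symmetric])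
      then have "real_of_int (m i + int n) = of_int (int (p i) + ((m i + int n) div int (n + 1)) * int (n + 1))"
        by (rule arg_cong)
      then show "x i = - real n / 2 + real (p i) + of_int ((m i + int n) div int (n + 1)) * real (n + 1)"
        using m[OF that] by simp
    qed
    ultimately show False using assms(2) unfolding perm_congruent_def by blast
  qed
  then obtain i j where "i \<le> n" "j \<le> n" "i \<noteq> j" "p i = p j" by (auto simp: inj_on_def)
  then obtain i j where ij: "i < j" "i \<le> n" "j \<le> n" "p i = p j" by (metis linorder_neqE_nat)
  have "(m i + int n) mod int (n + 1) = (m j + int n) mod int (n + 1)" using p_int ij by metis
  then obtain d where "m i + int n = m j + int n + int (n + 1) * d" by (metis mod_eqE)
  then have "m i = m j + d * int (n + 1)" by (simp add: algebra_simps)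
  then have "real_of_int (m i) = of_int (m j + d * int (n + 1))" by (rule arg_cong)
  then have "x i = x j + of_int d * real (n + 1)" using m ij by simp
  then show ?thesis using that ij by blast
qed

lemma theta_coeff_not_perm_congruent:
  assumes x: "x \<in> index_vectors n" and "\<nexists>p. perm_congruent n x p"
  shows "theta_coeff n \<tau> x = 0"
proof -
  obtain i j d where ij: "i < j" "j \<le> n" and d: "x i = x j + of_int (d :: int) * real (n + 1)"
    using not_perm_congruent_collision[OF assms] .
  define t where "t = Transposition.transpose i j"
  have t: "t permutes {0..n}" unfolding t_def using ij by (intro permutes_swap_id) auto
  \<comment> \<open>This translation exchanges x_i and x_j, which differ by d N. A permutation keeps
    the energy, so the translation law has factor q^0 and is compatible with antisymmetry only for a
    zero coefficient.\<close>
  define k where "k l = (if l = i then - d else if l = j then d else 0)" for l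
  have "(\<Sum>l=0..n. k l) = (\<Sum>l\<in>{i, j}. k l)"
    by (rule sum.mono_neutral_right) (use ij in \<open>auto simp: k_def\<close>)
  then have k: "(\<Sum>l=0..n. k l) = 0" using ij by (simp add: k_def)
  have e: "shift_by n k x = x \<circ> t"
    using d ij index_vectorsD(2)[OF x] by (auto simp: fun_eq_iff shift_by_def k_def t_def Transposition.transpose_def)
  have "theta_coeff n \<tau> (x \<circ> t) = theta_coeff n \<tau> x"
    using theta_coeff_shift[OF k x, of \<tau>] unfolding e energy_permute[OF t] by simp
  moreover have "theta_coeff n \<tau> (x \<circ> t) = - theta_coeff n \<tau> x"
    using theta_coeff_permute[OF t, of \<tau> x] ij by (simp add: t_def sign_swap_id)
  ultimately show ?thesis by simp
qed

lemma vector_sign_eq: "perm_congruent n x p \<Longrightarrow> vector_sign n x = sign p"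
  unfolding vector_sign_def using perm_congruent_unique by (metis the_equality)

text \<open>The factor C(\<tau>), read off at the Weyl vector, where the sign is 1.\<close>

definition macdonald_const :: "nat \<Rightarrow> complex \<Rightarrow> complex" where
  "macdonald_const n \<tau> = theta_coeff n \<tau> (weyl_vector n) * cpow \<tau> (- energy n (weyl_vector n))"

lemma theta_coeff_eq:
  assumes "x \<in> index_vectors n"
  shows "theta_coeff n \<tau> x = macdonald_const n \<tau> * (of_int (vector_sign n x) * cpow \<tau> (energy n x))"
proof (cases "\<exists>p. perm_congruent n x p")
  case True
  then obtain p where p: "perm_congruent n x p" by blast
  have "cpow \<tau> (energy n x - energy n (weyl_vector n)) = cpow \<tau> (energy n x) * cpow \<tau> (- energy n (weyl_vector n))"
    by (simp flip: cpow_add)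
  then show ?thesis
    unfolding theta_coeff_perm_congruent[OF assms p] vector_sign_eq[OF p] macdonald_const_def by simp
next
  case False
  then show ?thesis using theta_coeff_not_perm_congruent[OF assms] by (simp add: vector_sign_def)
qed

definition macdonald_term :: "nat \<Rightarrow> complex \<Rightarrow> (nat \<Rightarrow> complex) \<Rightarrow> (nat \<Rightarrow> real) \<Rightarrow> complex" where
  "macdonald_term n \<tau> u x = of_int (vector_sign n x) * cpow \<tau> (energy n x) * (\<Prod>i=0..n. cpow (u i) (x i))"

text \<open>The constant stays inside the summand: until it is known to be nonzero, only the
  multiplied series is known to converge.\<close>

theorem theta_product_eq_macdonald_const:
  assumes "Im \<tau> > 0"
  shows "((\<lambda>x. macdonald_const n \<tau> * macdonald_term n \<tau> u x) has_sum
     (\<Prod>(i, j)\<in>pairs n. jacobi_theta \<tau> (u i - u j))) (index_vectors n)"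
  using theta_product_has_sum[OF assms, of n u]
  by (rule has_sum_cong[THEN iffD1, rotated]) (simp add: theta_coeff_eq macdonald_term_def)

section \<open>Theta functions as infinite products and the lattice sum\<close>

text \<open>For r = 2k + 1 the character is (-1)^k = e(k/2), and r^2/8 has the linear part k/2. Both
  are absorbed into the argument u + \<tau>/2 + 1/2, which leaves a triple product series.\<close>

lemma theta_summand_odd:
  "theta_summand \<tau> u (2 * k + 1) = cpow \<tau> (1/8) * cpow u (1/2) * (cpow \<tau> (of_int k ^ 2 / 2) * cpow (u + \<tau> / 2 + 1/2) (of_int k))"
proof -
  have "kronecker_m4 (2 * k + 1) = (if even k then 1 else -1)"
    using kronecker_m4_shift[of 1 k] by (simp add: kronecker_m4_def add.commute)
  then have kr: "of_int (kronecker_m4 (2 * k + 1)) = cpow (1/2) (of_int k)"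
    by (simp add: cpow_half_int)
  have "real_of_int (2 * k + 1) ^ 2 / 8 = 1/8 + of_int k ^ 2 / 2 + of_int k / 2"
    by (simp add: power2_eq_square field_simps)
  then have t: "cpow \<tau> (real_of_int (2 * k + 1) ^ 2 / 8) = cpow \<tau> (1/8) * cpow \<tau> (of_int k ^ 2 / 2) * cpow \<tau> (of_int k / 2)"
    by (simp only: cpow_add)
  have "real_of_int (2 * k + 1) / 2 = 1/2 + of_int k" by (simp add: field_simps)
  then have u: "cpow u (real_of_int (2 * k + 1) / 2) = cpow u (1/2) * cpow u (of_int k)"
    by (simp only: cpow_add)
  have "cpow \<tau> (of_int k / 2) = cpow (\<tau> / 2) (of_int k)" by (simp add: cpow_def mult_ac)
  then show ?thesis
    unfolding theta_summand_def kr t u cpow_add_left by (simp only: mult_ac)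
qed

theorem jacobi_theta_product:
  assumes "Im \<tau> > 0"
  shows "jacobi_theta \<tau> u = cpow \<tau> (1/8) * (cpow u (1/2) - cpow u (-1/2)) * euler_phi \<tau> *
    (qprod \<tau> (cpow \<tau> 1 * cpow u 1) * qprod \<tau> (cpow \<tau> 1 * cpow (- u) 1))"
proof -
  define z where "z = u + \<tau> / 2 + 1/2"
  have "jacobi_theta \<tau> u = infsum (\<lambda>k. theta_summand \<tau> u (2 * k + 1)) UNIV"
    unfolding jacobi_theta_eq_odd
    by (rule infsum_reindex_bij_witness[where i = "\<lambda>k. 2 * k + 1" and j = "\<lambda>r. r div 2"]) auto
  also have "\<dots> = cpow \<tau> (1/8) * cpow u (1/2) * (euler_phi \<tau> * qprod \<tau> (- cpow \<tau> (1/2) * cpow z 1) * qprod \<tau> (- cpow \<tau> (1/2) * cpow (- z) 1))"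
    unfolding theta_summand_odd infsum_cmult_right' z_def[symmetric]
    using jacobi_triple_product[OF assms, of z] by (simp add: has_sum_iff)
  also have "- cpow \<tau> (1/2) * cpow z 1 = cpow \<tau> 1 * cpow u 1"
  proof -
    have "cpow z 1 = cpow u 1 * cpow \<tau> (1/2) * - 1"
      using cpow_half_int[of 1] unfolding z_def cpow_add_left by (simp add: cpow_def mult_ac)
    moreover have "cpow \<tau> (1/2) * cpow \<tau> (1/2) = cpow \<tau> 1" by (simp flip: cpow_add)
    ultimately show ?thesis by (simp add: mult_ac)
  qed
  also have "- cpow \<tau> (1/2) * cpow (- z) 1 = cpow (- u) 1"
  proof -
    have "cpow z 1 = cpow u 1 * cpow \<tau> (1/2) * - 1"
      using cpow_half_int[of 1] unfolding z_def cpow_add_left by (simp add: cpow_def mult_ac)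
    then show ?thesis by (simp add: cpow_minus(2))
  qed
  \<comment> \<open>The product with e(-u) starts at q^0; its first factor, joined with e(u/2),
    makes the odd factor e(u/2) - e(-u/2).\<close>
  also have "qprod \<tau> (cpow (- u) 1) = (1 - cpow (- u) 1) * qprod \<tau> (cpow \<tau> 1 * cpow (- u) 1)"
    using qprod_split_head[OF assms, of "cpow (- u) 1"] by (simp add: mult.commute)
  finally have "jacobi_theta \<tau> u = cpow \<tau> (1/8) * (cpow u (1/2) * (1 - cpow (- u) 1)) * euler_phi \<tau> *
    (qprod \<tau> (cpow \<tau> 1 * cpow u 1) * qprod \<tau> (cpow \<tau> 1 * cpow (- u) 1))"
    by (simp only: mult_ac)
  moreover have "cpow u (1/2) * cpow (- u) 1 = cpow u (-1/2)"
    using cpow_add[of u "1/2" "-1"] by (simp add: cpow_minus)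
  ultimately show ?thesis by (simp add: right_diff_distrib)
qed

section \<open>Infinite products over roots of unity and over residue classes\<close>

lemma cpow_scaled_power:
  "cpow (of_nat N * \<tau>) 1 = cpow \<tau> 1 ^ N"
  by (simp add: cpow_power) (simp add: cpow_def mult_ac)

text \<open>For each m the N factors 1 - c q^m \<omega>^j multiply to 1 - c^N q^(N m). The double
  product is exchanged at a finite cut-off, before the limit.\<close>

lemma qprod_roots_of_unity:
  assumes "Im \<tau> > 0" and \<omega>: "inj_on (\<lambda>i. \<omega> ^ i) {..<N}" "\<omega> ^ N = 1" and "N > 0"
  shows "(\<Prod>j<N. qprod \<tau> (c * \<omega> ^ j)) = qprod (of_nat N * \<tau>) (c ^ N)"
proof (rule LIMSEQ_unique)
  have "Im (of_nat N * \<tau>) > 0" using assms by simp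
  then show "(\<lambda>M. \<Prod>m<M. 1 - c ^ N * cpow (of_nat N * \<tau>) 1 ^ m) \<longlonglongrightarrow> qprod (of_nat N * \<tau>) (c ^ N)"
    by (rule qprod_LIMSEQ)
  have "(\<lambda>M. \<Prod>j<N. \<Prod>m<M. 1 - c * \<omega> ^ j * cpow \<tau> 1 ^ m) \<longlonglongrightarrow> (\<Prod>j<N. qprod \<tau> (c * \<omega> ^ j))"
    by (intro tendsto_prod qprod_LIMSEQ assms)
  also have "(\<lambda>M. \<Prod>j<N. \<Prod>m<M. 1 - c * \<omega> ^ j * cpow \<tau> 1 ^ m) = (\<lambda>M. \<Prod>m<M. 1 - c ^ N * cpow (of_nat N * \<tau>) 1 ^ m)"
  proof
    fix M
    have "(\<Prod>j<N. \<Prod>m<M. 1 - c * \<omega> ^ j * cpow \<tau> 1 ^ m) = (\<Prod>m<M. \<Prod>j<N. 1 - (c * cpow \<tau> 1 ^ m) * \<omega> ^ j)"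
      by (subst prod.swap) (simp only: mult_ac)
    also have "\<dots> = (\<Prod>m<M. 1 - c ^ N * cpow (of_nat N * \<tau>) 1 ^ m)"
      unfolding prod_roots_of_unity[OF \<omega> \<open>N > 0\<close>] cpow_scaled_power
      by (simp add: power_mult_distrib mult.commute flip: power_mult)
    finally show "(\<Prod>j<N. \<Prod>m<M. 1 - c * \<omega> ^ j * cpow \<tau> 1 ^ m) = (\<Prod>m<M. 1 - c ^ N * cpow (of_nat N * \<tau>) 1 ^ m)" .
  qed
  finally show "(\<lambda>M. \<Prod>m<M. 1 - c ^ N * cpow (of_nat N * \<tau>) 1 ^ m) \<longlonglongrightarrow> (\<Prod>j<N. qprod \<tau> (c * \<omega> ^ j))" .
qed

text \<open>Every exponent is uniquely i + N m with i < N. The cut-off M for \<open>m\<close> is the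
  cut-off M N for exponents, so the comparison runs along a subsequence of partial products.\<close>

lemma qprod_residue_classes:
  assumes "Im \<tau> > 0" and "N > 0"
  shows "(\<Prod>i<N. qprod (of_nat N * \<tau>) (c * cpow \<tau> 1 ^ i)) = qprod \<tau> c"
proof (rule LIMSEQ_unique)
  have "Im (of_nat N * \<tau>) > 0" using assms by simp
  then have "(\<lambda>M. \<Prod>i<N. \<Prod>m<M. 1 - c * cpow \<tau> 1 ^ i * cpow (of_nat N * \<tau>) 1 ^ m) \<longlonglongrightarrow>
      (\<Prod>i<N. qprod (of_nat N * \<tau>) (c * cpow \<tau> 1 ^ i))"
    by (intro tendsto_prod qprod_LIMSEQ)
  also have "(\<lambda>M. \<Prod>i<N. \<Prod>m<M. 1 - c * cpow \<tau> 1 ^ i * cpow (of_nat N * \<tau>) 1 ^ m) = (\<lambda>M. \<Prod>j<M * N. 1 - c * cpow \<tau> 1 ^ j)"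
  proof
    fix M
    have "(\<Prod>j<M * N. 1 - c * cpow \<tau> 1 ^ j) = (\<Prod>m<M. \<Prod>j\<in>{m * N..<m * N + N}. 1 - c * cpow \<tau> 1 ^ j)"
      by (rule prod.nat_group[symmetric])
    also have "\<dots> = (\<Prod>m<M. \<Prod>i<N. 1 - c * cpow \<tau> 1 ^ (i + m * N))"
    proof (rule prod.cong)
      fix m
      show "(\<Prod>j\<in>{m * N..<m * N + N}. 1 - c * cpow \<tau> 1 ^ j) = (\<Prod>i<N. 1 - c * cpow \<tau> 1 ^ (i + m * N))"
        using prod.shift_bounds_nat_ivl[of "\<lambda>j. 1 - c * cpow \<tau> 1 ^ j" 0 "m * N" N]
        by (simp add: atLeast0LessThan add.commute)
    qed simp
    also have "\<dots> = (\<Prod>i<N. \<Prod>m<M. 1 - c * cpow \<tau> 1 ^ i * cpow (of_nat N * \<tau>) 1 ^ m)"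
      unfolding cpow_scaled_power power_add by (subst prod.swap) (simp add: mult_ac flip: power_mult)
    finally show "(\<Prod>i<N. \<Prod>m<M. 1 - c * cpow \<tau> 1 ^ i * cpow (of_nat N * \<tau>) 1 ^ m) = (\<Prod>j<M * N. 1 - c * cpow \<tau> 1 ^ j)" ..
  qed
  finally show "(\<lambda>M. \<Prod>j<M * N. 1 - c * cpow \<tau> 1 ^ j) \<longlonglongrightarrow> (\<Prod>i<N. qprod (of_nat N * \<tau>) (c * cpow \<tau> 1 ^ i))" .
  have "filterlim (\<lambda>M. M * N) sequentially sequentially"
    using \<open>N > 0\<close> by (intro filterlim_subseq) (simp add: strict_mono_def)
  then show "(\<lambda>M. \<Prod>j<M * N. 1 - c * cpow \<tau> 1 ^ j) \<longlonglongrightarrow> qprod \<tau> c"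
    by (rule filterlim_compose[OF qprod_LIMSEQ[OF assms(1)]])
qed

section \<open>The lattice sum sliced by charge\<close>

text \<open>Charge 0 is the root lattice. The sum over all charges factors over the coordinates, the
  sum over a single slice does not.\<close>

definition charge_class :: "nat \<Rightarrow> int \<Rightarrow> (nat \<Rightarrow> int) set" where
  "charge_class n s = {k \<in> {0..n} \<rightarrow>\<^sub>E UNIV. (\<Sum>i=0..n. k i) = s}"

definition lattice_term :: "nat \<Rightarrow> complex \<Rightarrow> (nat \<Rightarrow> int) \<Rightarrow> complex" where
  "lattice_term n \<tau> k = cpow \<tau> (energy n (shift_by n k (weyl_vector n)))"

text \<open>
  Rotation maps the coordinates $\rho_i + N k_i$, as a multiset, to their translates by 1; it
  raises $\sum k$ by 1.
\<close>
definition rotate_up :: "nat \<Rightarrow> (nat \<Rightarrow> int) \<Rightarrow> nat \<Rightarrow> int" where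
  "rotate_up n k = (\<lambda>i\<in>{0..n}. if i = 0 then k n + 1 else k (i - 1))"

definition rotate_down :: "nat \<Rightarrow> (nat \<Rightarrow> int) \<Rightarrow> nat \<Rightarrow> int" where
  "rotate_down n k = (\<lambda>i\<in>{0..n}. if i = n then k 0 - 1 else k (i + 1))"

lemma sum_rotate_up: "(\<Sum>i=0..n. rotate_up n k i) = (\<Sum>i=0..n. k i) + 1"
proof -
  have "(\<Sum>i=0..n. rotate_up n k i) = rotate_up n k 0 + (\<Sum>i<n. rotate_up n k (Suc i))"
    by (simp add: atLeast0AtMost sum.lessThan_Suc_shift flip: lessThan_Suc_atMost del: sum.lessThan_Suc)
  also have "\<dots> = (k n + 1) + (\<Sum>i<n. k i)" by (simp add: rotate_up_def)
  also have "\<dots> = (\<Sum>i=0..n. k i) + 1" by (simp add: atLeast0AtMost flip: lessThan_Suc_atMost)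
  finally show ?thesis .
qed

text \<open>The wrapped coordinate fits because -n/2 + N (k_n + 1) = (n/2 + N k_n) + 1. Raising all
  coordinates y_i by 1 adds 2 sum y + N to the sum of squares, and sum y = N sum k.\<close>

lemma energy_rotate_up:
  "energy n (shift_by n (rotate_up n k) (weyl_vector n)) =
   energy n (shift_by n k (weyl_vector n)) + of_int (\<Sum>i=0..n. k i) + 1/2"
proof -
  define y where "y i = - real n / 2 + real i + of_int (k i) * real (n + 1)" for i
  define y' where "y' i = - real n / 2 + real i + of_int (rotate_up n k i) * real (n + 1)" for i
  have y0: "y' 0 = y n + 1" by (simp add: y_def y'_def rotate_up_def field_simps)
  have yS: "y' (Suc i) = y i + 1" if "i < n" for i using that by (simp add: y_def y'_def rotate_up_def)
  have "(\<Sum>i=0..n. y' i ^ 2) = y' 0 ^ 2 + (\<Sum>i<n. y' (Suc i) ^ 2)"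
    by (simp add: atLeast0AtMost sum.lessThan_Suc_shift flip: lessThan_Suc_atMost del: sum.lessThan_Suc)
  also have "\<dots> = (y n + 1) ^ 2 + (\<Sum>i<n. (y i + 1) ^ 2)" by (simp add: y0 yS)
  also have "\<dots> = (\<Sum>i=0..n. (y i + 1) ^ 2)" by (simp add: atLeast0AtMost flip: lessThan_Suc_atMost)
  also have "\<dots> = (\<Sum>i=0..n. y i ^ 2) + 2 * (\<Sum>i=0..n. y i) + real (n + 1)"
    by (simp add: power2_sum sum.distrib sum_distrib_left)
  also have "(\<Sum>i=0..n. y i) = real (n + 1) * of_int (\<Sum>i=0..n. k i)"
  proof -
    have "(\<Sum>i=0..n. y i) = (\<Sum>i=0..n. - real n / 2 + real i) + (\<Sum>i=0..n. of_int (k i) * real (n + 1))"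
      unfolding y_def by (rule sum.distrib)
    then show ?thesis unfolding sum_weyl_vector by (simp add: sum_distrib_left mult.commute)
  qed
  finally have eq: "(\<Sum>i=0..n. y' i ^ 2) = (\<Sum>i=0..n. y i ^ 2) + 2 * (real (n + 1) * of_int (\<Sum>i=0..n. k i)) + real (n + 1)" .
  have alg: "(S + 2 * (N * a) + N) / (2 * N) = S / (2 * N) + a + 1/2" if "N \<noteq> 0" for S N a :: real
    using that by (simp add: field_simps)
  have e: "energy n (shift_by n k (weyl_vector n)) = (\<Sum>i=0..n. y i ^ 2) / (2 * real (n + 1))"
    "energy n (shift_by n (rotate_up n k) (weyl_vector n)) = (\<Sum>i=0..n. y' i ^ 2) / (2 * real (n + 1))"
    unfolding energy_def y_def y'_def
    by (intro arg_cong2[where f = "(/)"] sum.cong refl; simp add: shift_by_def weyl_vector_def)+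
  show ?thesis unfolding e eq by (rule alg) simp
qed

lemma rotate_inverse:
  assumes "k \<in> {0..n} \<rightarrow>\<^sub>E UNIV"
  shows "rotate_up n (rotate_down n k) = k" "rotate_down n (rotate_up n k) = k"
  using assms by (auto simp: rotate_up_def rotate_down_def fun_eq_iff PiE_def extensional_def)

lemma infsum_charge_class_Suc:
  "infsum (lattice_term n \<tau>) (charge_class n (s + 1)) = cpow \<tau> (of_int s + 1/2) * infsum (lattice_term n \<tau>) (charge_class n s)"
proof -
  have "infsum (\<lambda>k. cpow \<tau> (of_int s + 1/2) * lattice_term n \<tau> k) (charge_class n s) =
     infsum (lattice_term n \<tau>) (charge_class n (s + 1))"
  proof (rule infsum_reindex_bij_witness[where i = "rotate_down n" and j = "rotate_up n"])
    fix k assume k: "k \<in> charge_class n s"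
    then show "rotate_down n (rotate_up n k) = k" by (simp add: charge_class_def rotate_inverse)
    show "rotate_up n k \<in> charge_class n (s + 1)"
      using k sum_rotate_up[of n k] by (auto simp: charge_class_def rotate_up_def)
    have "(\<Sum>i=0..n. k i) = s" using k by (simp add: charge_class_def)
    then show "lattice_term n \<tau> (rotate_up n k) = cpow \<tau> (of_int s + 1/2) * lattice_term n \<tau> k"
      unfolding lattice_term_def energy_rotate_up by (simp add: add.assoc mult.commute flip: cpow_add)
  next
    fix k assume k: "k \<in> charge_class n (s + 1)"
    then show u: "rotate_up n (rotate_down n k) = k" by (simp add: charge_class_def rotate_inverse)
    then have "(\<Sum>i=0..n. rotate_down n k i) + 1 = s + 1"
      using sum_rotate_up[of n "rotate_down n k"] k by (simp add: charge_class_def)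
    then show "rotate_down n k \<in> charge_class n s"
      by (simp add: charge_class_def) (simp add: rotate_down_def)
  qed
  then show ?thesis by (simp add: infsum_cmult_right')
qed

text \<open>The increments s + 1/2 telescope to s^2/2, upwards and downwards from 0.\<close>

lemma infsum_charge_class:
  "infsum (lattice_term n \<tau>) (charge_class n s) = cpow \<tau> (of_int s ^ 2 / 2) * infsum (lattice_term n \<tau>) (charge_class n 0)"
proof (induction s rule: int_induct[where k = 0])
  case base
  then show ?case by simp
next
  case (step1 i)
  have "real_of_int (i + 1) ^ 2 / 2 = (of_int i + 1/2) + of_int i ^ 2 / 2"
    by (simp add: power2_eq_square field_simps)
  then have "cpow \<tau> (real_of_int (i + 1) ^ 2 / 2) = cpow \<tau> (of_int i + 1/2) * cpow \<tau> (of_int i ^ 2 / 2)"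
    by (simp only: cpow_add)
  then show ?case unfolding infsum_charge_class_Suc step1.IH by simp
next
  case (step2 i)
  have "real_of_int i ^ 2 / 2 = (of_int (i - 1) + 1/2) + of_int (i - 1) ^ 2 / 2"
    by (simp add: power2_eq_square field_simps)
  then have "cpow \<tau> (real_of_int i ^ 2 / 2) = cpow \<tau> (of_int (i - 1) + 1/2) * cpow \<tau> (of_int (i - 1) ^ 2 / 2)"
    by (simp only: cpow_add)
  then show ?case using step2.IH infsum_charge_class_Suc[of n \<tau> "i - 1"] by simp
qed

text \<open>Each coordinate gives a triple product at N \<tau> with argument \<rho>_i \<tau>. Its
  two products start at -q^(1/2 + i) and -q^(1/2 + n - i); as i runs through 0..n, each family meets
  every residue class modulo N once and reassembles to
  \<open>qprod \<tau> (- cpow \<tau> (1/2))\<close>, whence the square.\<close>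

lemma lattice_term_has_sum:
  assumes "Im \<tau> > 0"
  shows "(lattice_term n \<tau> has_sum cpow \<tau> (energy n (weyl_vector n)) * euler_phi (of_nat (n + 1) * \<tau>) ^ (n + 1) *
     qprod \<tau> (- cpow \<tau> (1/2)) ^ 2) ({0..n} \<rightarrow>\<^sub>E UNIV)"
proof -
  define N where "N = n + 1"
  define a where "a i = - real n / 2 + real i" for i
  define \<gamma> where "\<gamma> i m = cpow \<tau> ((a i + of_int m * real N) ^ 2 / (2 * real N))" for i and m :: int
  define B where "B i = qprod (of_nat N * \<tau>) (- cpow \<tau> (1/2) * cpow \<tau> 1 ^ i)" for i
  have N: "real N \<noteq> 0" "N > 0" by (simp_all add: N_def)
  have Im: "Im (of_nat N * \<tau>) > 0" using assms by (simp add: N_def)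
  have \<gamma>: "(\<gamma> i has_sum cpow \<tau> (a i ^ 2 / (2 * real N)) * (euler_phi (of_nat N * \<tau>) * B i * B (n - i))) UNIV" if i: "i \<le> n" for i
  proof -
    have g: "\<gamma> i m = cpow \<tau> (a i ^ 2 / (2 * real N)) * (cpow (of_nat N * \<tau>) (of_int m ^ 2 / 2) * cpow (of_real (a i) * \<tau>) (of_int m))" for m
    proof -
      have "(a i + of_int m * real N) ^ 2 / (2 * real N) = a i ^ 2 / (2 * real N) + (real N * (of_int m ^ 2 / 2) + a i * of_int m)"
        using N by (simp add: power2_eq_square field_simps)
      moreover have "cpow (of_nat N * \<tau>) t = cpow \<tau> (real N * t)" for t
        using cpow_mult_of_real[of "real N" \<tau> t] by simp
      ultimately show ?thesis unfolding \<gamma>_def cpow_mult_of_real by (simp only: cpow_add)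
    qed
    have N2: "cpow (of_nat N * \<tau>) (1/2) = cpow \<tau> (real N / 2)"
      using cpow_mult_of_real[of "real N" \<tau> "1/2"] by simp
    have b1: "- cpow (of_nat N * \<tau>) (1/2) * cpow (of_real (a i) * \<tau>) 1 = - cpow \<tau> (1/2) * cpow \<tau> 1 ^ i"
    proof -
      have "real N / 2 + a i * 1 = 1/2 + real i * 1" by (simp add: N_def a_def field_simps)
      then have "cpow \<tau> (real N / 2) * cpow \<tau> (a i * 1) = cpow \<tau> (1/2) * cpow \<tau> (real i * 1)"
        by (simp only: cpow_add[symmetric])
      then show ?thesis unfolding N2 cpow_mult_of_real cpow_power by simp
    qed
    have b2: "- cpow (of_nat N * \<tau>) (1/2) * cpow (- (of_real (a i) * \<tau>)) 1 = - cpow \<tau> (1/2) * cpow \<tau> 1 ^ (n - i)"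
    proof -
      have "real N / 2 + - a i * 1 = 1/2 + real (n - i) * 1" using i by (simp add: N_def a_def of_nat_diff field_simps)
      then have "cpow \<tau> (real N / 2) * cpow \<tau> (- a i * 1) = cpow \<tau> (1/2) * cpow \<tau> (real (n - i) * 1)"
        by (simp only: cpow_add[symmetric])
      moreover have "cpow (- (of_real (a i) * \<tau>)) 1 = cpow \<tau> (- a i * 1)"
        using cpow_mult_of_real[of "- a i" \<tau> 1] by simp
      ultimately show ?thesis unfolding N2 cpow_power by simp
    qed
    show ?thesis
      unfolding g[abs_def] using jacobi_triple_product[OF Im, of "of_real (a i) * \<tau>"] unfolding b1 b2 B_def
      by (intro has_sum_cmult_right)
  qed
  have "((\<lambda>k. \<Prod>i=0..n. \<gamma> i (k i)) has_sum (\<Prod>i=0..n. infsum (\<gamma> i) UNIV)) ({0..n} \<rightarrow>\<^sub>E UNIV)"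
    by (rule has_sum_prod_PiE) (auto intro: has_sum_imp_summable[OF \<gamma>])
  moreover have "(\<Prod>i=0..n. \<gamma> i (k i)) = lattice_term n \<tau> k" for k
    unfolding \<gamma>_def cpow_sum[symmetric] lattice_term_def energy_def
    by (simp add: sum_divide_distrib shift_by_def weyl_vector_def a_def N_def)
  moreover have "(\<Prod>i=0..n. infsum (\<gamma> i) UNIV) = cpow \<tau> (energy n (weyl_vector n)) * euler_phi (of_nat N * \<tau>) ^ N * qprod \<tau> (- cpow \<tau> (1/2)) ^ 2"
  proof -
    have "(\<Prod>i=0..n. infsum (\<gamma> i) UNIV) = (\<Prod>i=0..n. cpow \<tau> (a i ^ 2 / (2 * real N)) * (euler_phi (of_nat N * \<tau>) * B i * B (n - i)))"
      by (intro prod.cong refl) (use \<gamma> in \<open>auto simp: has_sum_iff\<close>)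
    also have "\<dots> = cpow \<tau> (\<Sum>i=0..n. a i ^ 2 / (2 * real N)) * (euler_phi (of_nat N * \<tau>) ^ N * (\<Prod>i=0..n. B i) * (\<Prod>i=0..n. B (n - i)))"
      by (simp add: prod.distrib cpow_sum N_def)
    also have "(\<Sum>i=0..n. a i ^ 2 / (2 * real N)) = energy n (weyl_vector n)"
      by (simp add: energy_def weyl_vector_def a_def N_def sum_divide_distrib)
    also have "(\<Prod>i=0..n. B (n - i)) = (\<Prod>i=0..n. B i)"
      by (rule prod.reindex_bij_witness[where i = "\<lambda>i. n - i" and j = "\<lambda>i. n - i"]) auto
    also have "(\<Prod>i=0..n. B i) = qprod \<tau> (- cpow \<tau> (1/2))"
      using qprod_residue_classes[OF assms \<open>N > 0\<close>, of "- cpow \<tau> (1/2)"]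
      by (simp add: B_def N_def atLeast0AtMost flip: lessThan_Suc_atMost)
    finally show ?thesis by (simp add: power2_eq_square mult_ac)
  qed
  ultimately show ?thesis by (simp add: N_def)
qed

text \<open>The sum over Z^N is computed coordinatewise and slice by slice. The slices bring in the
  sum of q^(s^2/2), a triple product at z = 0; the factor \<open>b ^ 2\<close> common to both
  results is nonzero because |q^(1/2)| < 1, and it cancels.\<close>

theorem infsum_charge_class_0:
  assumes "Im \<tau> > 0"
  shows "infsum (lattice_term n \<tau>) (charge_class n 0) * euler_phi \<tau> =
     cpow \<tau> (energy n (weyl_vector n)) * euler_phi (of_nat (n + 1) * \<tau>) ^ (n + 1)"
proof -
  define G where "G = infsum (lattice_term n \<tau>) (charge_class n 0)"
  define E where "E = ({0..n} \<rightarrow>\<^sub>E UNIV :: (nat \<Rightarrow> int) set)"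
  define b where "b = qprod \<tau> (- cpow \<tau> (1/2))"
  define T where "T = cpow \<tau> (energy n (weyl_vector n)) * euler_phi (of_nat (n + 1) * \<tau>) ^ (n + 1) * b ^ 2"
  have "norm (- cpow \<tau> (1/2)) < 1" using norm_cpow_less_1[OF assms, of "1/2"] by simp
  then have b: "b \<noteq> 0" unfolding b_def by (rule qprod_nonzero'[OF assms])
  have cc: "charge_class n s = {k \<in> E. (\<Sum>i=0..n. k i) = s}" for s
    by (simp add: charge_class_def E_def)
  have T: "(lattice_term n \<tau> has_sum T) E"
    unfolding T_def E_def b_def by (rule lattice_term_has_sum[OF assms])
  also have "?this \<longleftrightarrow> ((\<lambda>(s, k). lattice_term n \<tau> k) has_sum T) (Sigma UNIV (charge_class n))"
    by (rule has_sum_reindex_bij_witness[where i = snd and j = "\<lambda>k. (\<Sum>i=0..n. k i, k)"])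
      (auto simp: cc)
  finally have S: "((\<lambda>(s, k). lattice_term n \<tau> k) has_sum T) (Sigma UNIV (charge_class n))" .
  have "((\<lambda>s. cpow \<tau> (of_int s ^ 2 / 2) * G) has_sum T) UNIV"
  proof (rule has_sum_SigmaD[OF S])
    fix s :: int
    have "lattice_term n \<tau> summable_on charge_class n s"
      by (rule summable_on_subset_banach[OF has_sum_imp_summable[OF T]]) (auto simp: cc)
    then have "(lattice_term n \<tau> has_sum cpow \<tau> (of_int s ^ 2 / 2) * G) (charge_class n s)"
      unfolding G_def infsum_charge_class[of n \<tau> s, symmetric] by (rule has_sum_infsum)
    then show "((\<lambda>k. case (s, k) of (s, k) \<Rightarrow> lattice_term n \<tau> k) has_sum cpow \<tau> (of_int s ^ 2 / 2) * G) (charge_class n s)"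
      by simp
  qed
  moreover have "((\<lambda>s. cpow \<tau> (of_int s ^ 2 / 2) * G) has_sum (euler_phi \<tau> * b * b) * G) UNIV"
    using has_sum_cmult_left[OF jacobi_triple_product[OF assms, of 0], of G] by (simp add: b_def)
  ultimately have "T = (euler_phi \<tau> * b * b) * G" by (rule has_sum_unique)
  then show ?thesis using b by (simp add: T_def G_def[symmetric] power2_eq_square)
qed

section \<open>Evaluation of the constant\<close>

lemma card_pairs: "card (pairs n) = n * (n + 1) div 2"
proof -
  have "card (pairs n) = (\<Sum>(i, j)\<in>pairs n. 1)" by (simp add: case_prod_unfold)
  also have "\<dots> = (\<Sum>j<Suc n. \<Sum>i<j. 1)" by (rule sum.pairs_Suc_nested)
  also have "\<dots> = (\<Sum>j<Suc n. j)" by simp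
  also have "\<dots> = n * (n + 1) div 2" by (induction n) auto
  finally show ?thesis .
qed

text \<open>The strange formula of Freudenthal and de Vries for A_n, whose dimension is n (n + 2).
  It makes the powers of q in the constant agree with those of eta.\<close>

lemma energy_weyl_vector: "energy n (weyl_vector n) = real n * (real n + 2) / 24"
proof -
  \<comment> \<open>The centre n/2 is freed to \<open>c\<close>, for otherwise it would move with n
    during the induction.\<close>
  have "(\<Sum>i=0..n. (- c + real i)^2) = (real n + 1) * c ^ 2 - c * real n * (real n + 1) + real n * (real n + 1) * (2 * real n + 1) / 6" for c
    by (induction n) (simp_all add: power2_eq_square field_simps)
  from this[of "real n / 2"] have "(\<Sum>i=0..n. (- real n / 2 + real i)^2) = real n * (real n + 1) * (real n + 2) / 12"
    by (simp add: power2_eq_square field_simps)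
  then show ?thesis by (simp add: energy_def weyl_vector_def field_simps)
qed

lemma inj_on_root_power:
  fixes N :: nat
  assumes "N > 0"
  defines "\<omega> \<equiv> cpow (1 / of_nat N) 1"
  shows "inj_on (\<lambda>i. \<omega> ^ i) {..<N}" "inj_on (\<lambda>i. inverse \<omega> ^ i) {..<N}" "\<omega> ^ N = 1"
proof -
  have p: "\<omega> ^ i = exp (2 * of_real pi * \<i> * of_nat i / of_nat N)" for i
    unfolding \<omega>_def cpow_power by (simp add: cpow_def)
  show *: "inj_on (\<lambda>i. \<omega> ^ i) {..<N}"
  proof (rule inj_onI)
    fix i j assume ij: "i \<in> {..<N}" "j \<in> {..<N}" "\<omega> ^ i = \<omega> ^ j"
    then have "i mod N = j mod N"
      using complex_root_unity_eq[of N i j] assms(1) unfolding p by simp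
    then show "i = j" using ij by simp
  qed
  then show "inj_on (\<lambda>i. inverse \<omega> ^ i) {..<N}" by (simp add: inj_on_def power_inverse)
  show "\<omega> ^ N = 1" unfolding p using assms(1) by simp
qed

section \<open>Specialization at the points j/N\<close>

locale equally_spaced =
  fixes n :: nat and \<tau> :: complex
  assumes Im_tau: "Im \<tau> > 0"
begin

definition node :: "nat \<Rightarrow> complex" where "node j = of_nat j / of_nat (n + 1)"
definition omega :: complex where "omega = cpow (1 / of_nat (n + 1)) 1"
text \<open>Collects the half-integral powers e(-u_i/2), one for each pair containing i. It occurs
  on both sides of the specialized identity and cancels.\<close>

definition phase :: complex where "phase = (\<Prod>i=0..n. cpow (node i) (- 1/2)) ^ n"
definition vandermonde_det :: complex where "vandermonde_det = (\<Prod>j<Suc n. \<Prod>i<j. omega ^ j - omega ^ i)"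

lemma cpow_node: "cpow (node j) 1 = omega ^ j"
  unfolding omega_def cpow_power by (simp add: node_def cpow_def)

lemma omega: "inj_on (\<lambda>i. omega ^ i) {..<Suc n}" "inj_on (\<lambda>i. inverse omega ^ i) {..<Suc n}" "omega ^ Suc n = 1"
  using inj_on_root_power[of "n + 1"] by (simp_all add: omega_def)

lemma omega_nonzero: "omega \<noteq> 0" by (simp add: omega_def)

lemma phase_nonzero: "phase \<noteq> 0" by (simp add: phase_def)

lemma vandermonde_det_nonzero: "vandermonde_det \<noteq> 0"
proof -
  have "omega ^ j - omega ^ i \<noteq> 0" if "j < Suc n" "i < j" for i j
    using inj_onD[OF omega(1), of j i] that by auto
  then show ?thesis unfolding vandermonde_det_def by (simp del: prod.lessThan_Suc)
qed

text \<open>Pulling e(-u_i/2) e(-u_j/2) out of the factor of i < j leaves \<omega>^i - \<omega>^j,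
  the opposite of the Vandermonde orientation. This is the source of the sign in the final
  formula.\<close>

lemma prod_half_differences:
  "(\<Prod>(i, j)\<in>pairs n. cpow (node i - node j) (1/2) - cpow (node i - node j) (- 1/2)) =
    (- 1) ^ card (pairs n) * phase * vandermonde_det"
proof -
  define h where "h i = cpow (node i) (- 1/2)" for i
  have half: "cpow (node i) (1/2) = h i * omega ^ i" for i
    unfolding h_def cpow_node[symmetric] cpow_add[symmetric] by simp
  have "cpow (node i - node j) (1/2) - cpow (node i - node j) (- 1/2) = - 1 * (h i * h j) * (omega ^ j - omega ^ i)" for i j
  proof -
    have "cpow (node i - node j) s = cpow (node i) s * cpow (node j) (- s)" for s
      using cpow_add_left[of "node i" "- node j" s] by (simp add: cpow_minus)
    then have "cpow (node i - node j) (1/2) - cpow (node i - node j) (- 1/2) =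
       cpow (node i) (1/2) * h j - h i * cpow (node j) (1/2)" by (simp add: h_def)
    then show ?thesis unfolding half by (simp add: algebra_simps)
  qed
  then have "(\<Prod>(i, j)\<in>pairs n. cpow (node i - node j) (1/2) - cpow (node i - node j) (- 1/2)) =
    (\<Prod>(i, j)\<in>pairs n. - 1) * (\<Prod>(i, j)\<in>pairs n. h i * h j) * (\<Prod>(i, j)\<in>pairs n. omega ^ j - omega ^ i)"
    by (simp only: prod.distrib case_prod_unfold)
  also have "(\<Prod>(i, j)\<in>pairs n. h i * h j) = phase"
    unfolding prod.pairs_symmetrize[of "\<lambda>i j. h i"] by (simp add: prod_power_distrib phase_def h_def)
  also have "(\<Prod>(i, j)\<in>pairs n. omega ^ j - omega ^ i) = vandermonde_det"
    unfolding vandermonde_det_def by (rule prod.pairs_Suc_nested)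
  finally show ?thesis by (simp add: case_prod_unfold)
qed

text \<open>In row i the ratios \<omega>^(i - j) run over all N-th roots of unity, so a full row
  gives the Euler function at N \<tau>. The omitted diagonal entry is
  \<open>euler_phi \<tau>\<close>, hence one quotient for each of the N rows.\<close>

lemma prod_qprod_differences:
  "(\<Prod>(i, j)\<in>pairs n. qprod \<tau> (cpow \<tau> 1 * cpow (node i - node j) 1) * qprod \<tau> (cpow \<tau> 1 * cpow (- (node i - node j)) 1)) =
    (euler_phi (of_nat (n + 1) * \<tau>) / euler_phi \<tau>) ^ (n + 1)"
proof -
  define Q where "Q i j = qprod \<tau> (cpow \<tau> 1 * omega ^ i * inverse omega ^ j)" for i j
  have d: "cpow (node i - node j) 1 = omega ^ i * inverse omega ^ j" for i j
    using cpow_add_left[of "node i" "- node j" 1] by (simp add: cpow_minus cpow_node power_inverse)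
  have "(\<Prod>(i, j)\<in>pairs n. qprod \<tau> (cpow \<tau> 1 * cpow (node i - node j) 1) * qprod \<tau> (cpow \<tau> 1 * cpow (- (node i - node j)) 1)) =
    (\<Prod>(i, j)\<in>pairs n. Q i j * Q j i)"
    by (simp add: Q_def d mult.assoc)
  also have "\<dots> = (\<Prod>i=0..n. \<Prod>j\<in>{0..n} - {i}. Q i j)" by (rule prod.pairs_symmetrize)
  also have "\<dots> = (\<Prod>i=0..n. euler_phi (of_nat (n + 1) * \<tau>) / euler_phi \<tau>)"
  proof (rule prod.cong)
    fix i assume i: "i \<in> {0..n}"
    have diag: "Q i i = euler_phi \<tau>"
      by (simp add: Q_def euler_phi_def power_inverse omega_nonzero mult.assoc)
    have "(\<Prod>j=0..n. Q i j) = (\<Prod>j<Suc n. Q i j)"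
      by (simp only: atLeast0AtMost lessThan_Suc_atMost)
    also have "\<dots> = qprod (of_nat (Suc n) * \<tau>) ((cpow \<tau> 1 * omega ^ i) ^ Suc n)"
      unfolding Q_def
      by (rule qprod_roots_of_unity[OF Im_tau omega(2)]) (use omega(3) in \<open>simp_all add: power_inverse del: power_Suc\<close>)
    also have "(cpow \<tau> 1 * omega ^ i) ^ Suc n = cpow (of_nat (Suc n) * \<tau>) 1"
    proof -
      have "(omega ^ i) ^ Suc n = (omega ^ Suc n) ^ i" by (simp only: power_mult[symmetric] mult.commute)
      then show ?thesis unfolding cpow_scaled_power power_mult_distrib omega(3) by simp
    qed
    finally have "(\<Prod>j=0..n. Q i j) = euler_phi (of_nat (n + 1) * \<tau>)" by (simp add: euler_phi_def)
    then have "euler_phi \<tau> * (\<Prod>j\<in>{0..n} - {i}. Q i j) = euler_phi (of_nat (n + 1) * \<tau>)"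
      using prod.remove[of "{0..n}" i "Q i"] i diag by simp
    then show "(\<Prod>j\<in>{0..n} - {i}. Q i j) = euler_phi (of_nat (n + 1) * \<tau>) / euler_phi \<tau>"
      using euler_phi_nonzero[OF Im_tau] by (simp add: field_simps)
  qed simp
  finally show ?thesis by simp
qed

lemma theta_product_at_nodes:
  "(\<Prod>(i, j)\<in>pairs n. jacobi_theta \<tau> (node i - node j)) =
    (- 1) ^ card (pairs n) * phase * vandermonde_det * (cpow \<tau> (1/8) * euler_phi \<tau>) ^ card (pairs n) *
    (euler_phi (of_nat (n + 1) * \<tau>) / euler_phi \<tau>) ^ (n + 1)"
proof -
  have "(\<Prod>(i, j)\<in>pairs n. jacobi_theta \<tau> (node i - node j)) =
    (\<Prod>(i, j)\<in>pairs n. cpow \<tau> (1/8) * euler_phi \<tau>) *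
    (\<Prod>(i, j)\<in>pairs n. cpow (node i - node j) (1/2) - cpow (node i - node j) (- 1/2)) *
    (\<Prod>(i, j)\<in>pairs n. qprod \<tau> (cpow \<tau> 1 * cpow (node i - node j) 1) * qprod \<tau> (cpow \<tau> 1 * cpow (- (node i - node j)) 1))"
    unfolding jacobi_theta_product[OF Im_tau] by (simp only: prod.distrib case_prod_unfold mult_ac)
  then show ?thesis unfolding prod_half_differences prod_qprod_differences by (simp add: case_prod_unfold)
qed

lemma theta_product_at_nodes_nonzero: "(\<Prod>(i, j)\<in>pairs n. jacobi_theta \<tau> (node i - node j)) \<noteq> 0"
proof -
  have "Im (of_nat (n + 1) * \<tau>) > 0" using Im_tau by simp
  then have "euler_phi (of_nat (n + 1) * \<tau>) \<noteq> 0" by (rule euler_phi_nonzero)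
  then show ?thesis
    unfolding theta_product_at_nodes using euler_phi_nonzero[OF Im_tau] phase_nonzero vandermonde_det_nonzero
    by (simp add: power_mult_distrib)
qed

text \<open>A vanishing constant would make the theta product zero at the nodes, where its explicit
  value is not zero.\<close>

lemma macdonald_const_nonzero: "macdonald_const n \<tau> \<noteq> 0"
proof
  assume "macdonald_const n \<tau> = 0"
  then have "((\<lambda>x. 0) has_sum (\<Prod>(i, j)\<in>pairs n. jacobi_theta \<tau> (node i - node j))) (index_vectors n)"
    using theta_product_eq_macdonald_const[OF Im_tau, of n node] by simp
  then have "(\<Prod>(i, j)\<in>pairs n. jacobi_theta \<tau> (node i - node j)) = 0"
    by (rule has_sum_unique[OF _ has_sum_0_simp])
  then show False using theta_product_at_nodes_nonzero by contradiction
qed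

lemma macdonald_term_summable: "macdonald_term n \<tau> u summable_on index_vectors n"
  by (rule summable_on_cmult_right'[THEN iffD1, OF macdonald_const_nonzero
        has_sum_imp_summable[OF theta_product_eq_macdonald_const[OF Im_tau]]])

text \<open>At the nodes e(u_i N k_i) = e(i k_i) = 1, so \<open>k\<close> is felt only through the
  energy. There the permutation moves from the Weyl vector \<rho> to the translation: x = (\<rho> +
  N (k \<circ> inv p)) \<circ> p.\<close>

lemma macdonald_term_at_nodes:
  assumes p: "p permutes {0..n}" and k: "k \<in> charge_class n 0"
  shows "macdonald_term n \<tau> node (shift_by n k (weyl_vector n \<circ> p)) =
    phase * (of_int (sign p) * (\<Prod>i<Suc n. (omega ^ i) ^ p i)) * lattice_term n \<tau> (k \<circ> inv p)"
proof -
  have pin: "p i \<le> n \<longleftrightarrow> i \<le> n" for i using permutes_in_image[OF p, of i] by simp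
  define x where "x = shift_by n k (weyl_vector n \<circ> p)"
  have x: "x i = - real n / 2 + real (p i) + of_int (k i) * real (n + 1)" if "i \<le> n" for i
    using that pin by (simp add: x_def shift_by_def weyl_vector_def)
  have "perm_congruent n x p" using p x unfolding perm_congruent_def by blast
  then have sg: "vector_sign n x = sign p" by (rule vector_sign_eq)
  have "x = shift_by n (k \<circ> inv p) (weyl_vector n) \<circ> p"
    using pin permutes_inverses[OF p] by (auto simp: x_def shift_by_def fun_eq_iff)
  then have en: "cpow \<tau> (energy n x) = lattice_term n \<tau> (k \<circ> inv p)"
    by (simp add: lattice_term_def energy_permute[OF p])
  have "(\<Prod>i=0..n. cpow (node i) (x i)) = (\<Prod>i=0..n. cpow (node i) (- 1/2) ^ n * (omega ^ i) ^ p i)"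
  proof (rule prod.cong)
    fix i assume "i \<in> {0..n}"
    then have xi: "x i = real n * (- 1/2) + real (p i) * 1 + of_int (k i) * real (n + 1)" using x by simp
    define N where "N = complex_of_nat (n + 1)"
    have N: "N \<noteq> 0" unfolding N_def by (simp del: of_nat_add of_nat_Suc)
    have "complex_of_real (of_int (k i) * real (n + 1)) = of_int (k i) * N" by (simp add: N_def)
    then have "cpow (node i) (of_int (k i) * real (n + 1)) = cpow (of_int (int i)) (of_int (k i))"
      using N unfolding node_def cpow_def N_def[symmetric] by (simp add: field_simps)
    then have "cpow (node i) (of_int (k i) * real (n + 1)) = 1" by (simp only: cpow_int_period)
    then show "cpow (node i) (x i) = cpow (node i) (- 1/2) ^ n * (omega ^ i) ^ p i"
      unfolding xi cpow_add cpow_node[symmetric] cpow_power by simp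
  qed simp
  also have "\<dots> = phase * (\<Prod>i<Suc n. (omega ^ i) ^ p i)"
    by (simp add: prod.distrib phase_def prod_power_distrib atLeast0AtMost lessThan_Suc_atMost del: prod.lessThan_Suc)
  finally show ?thesis
    unfolding macdonald_term_def x_def[symmetric] sg en by simp
qed

lemma infsum_lattice_term_permute:
  assumes p: "p permutes {0..n}"
  shows "((\<lambda>k. lattice_term n \<tau> (k \<circ> inv p)) has_sum infsum (lattice_term n \<tau>) (charge_class n 0)) (charge_class n 0)"
proof -
  have "lattice_term n \<tau> summable_on charge_class n 0"
    by (rule summable_on_subset_banach[OF has_sum_imp_summable[OF lattice_term_has_sum[OF Im_tau]]])
      (auto simp: charge_class_def)
  then have "(lattice_term n \<tau> has_sum infsum (lattice_term n \<tau>) (charge_class n 0)) (charge_class n 0)"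
    by (rule has_sum_infsum)
  moreover have mem: "k \<circ> p \<in> charge_class n 0" if "k \<in> charge_class n 0" and p: "p permutes {0..n}" for k p
  proof -
    have "p i \<le> n \<longleftrightarrow> i \<le> n" for i using permutes_in_image[OF p, of i] by simp
    then show ?thesis using that(1) sum.permute[OF p, of k]
      by (auto simp: charge_class_def PiE_def extensional_def o_def)
  qed
  moreover have "k \<circ> inv p \<circ> p = k" "k \<circ> p \<circ> inv p = k" for k :: "nat \<Rightarrow> int"
    by (simp_all add: fun_eq_iff permutes_inverses[OF p])
  ultimately show ?thesis
    using permutes_inv[OF p]
    by (subst has_sum_reindex_bij_witness[where i = "\<lambda>k. k \<circ> p" and j = "\<lambda>k. k \<circ> inv p" and T = "charge_class n 0" and h = "lattice_term n \<tau>", OF _ _ _ _ _ refl])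
      (use p in auto)
qed

text \<open>The support of \<open>vector_sign\<close> is parametrized by a permutation and a
  translation of charge 0: uniqueness of the congruent permutation determines \<open>p\<close>, and
  then \<open>k\<close>. The root lattice is invariant under permutations, so every inner sum is the
  same \<open>G\<close> times one summand of the determinant.\<close>

lemma infsum_macdonald_term_at_nodes:
  "infsum (macdonald_term n \<tau> node) (index_vectors n) =
    phase * vandermonde_det * infsum (lattice_term n \<tau>) (charge_class n 0)"
proof -
  define S where "S = infsum (macdonald_term n \<tau> node) (index_vectors n)"
  define G where "G = infsum (lattice_term n \<tau>) (charge_class n 0)"
  define A where "A = {p. p permutes {0..n}}"
  define to where "to = (\<lambda>(p, k). shift_by n k (weyl_vector n \<circ> p))"
  have perm_to: "perm_congruent n (shift_by n k (weyl_vector n \<circ> p)) p" if p: "p \<in> A" for p k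
  proof -
    have p: "p permutes {0..n}" using p by (simp add: A_def)
    have "p i \<le> n \<longleftrightarrow> i \<le> n" for i using permutes_in_image[OF p, of i] by simp
    then have "shift_by n k (weyl_vector n \<circ> p) i = - real n / 2 + real (p i) + of_int (k i) * real (n + 1)" if "i \<le> n" for i
      using that by (simp add: shift_by_def weyl_vector_def)
    then show ?thesis using p unfolding perm_congruent_def by blast
  qed
  have "inj_on to (A \<times> charge_class n 0)"
  proof (rule inj_onI, clarify)
    fix p k p' k' assume pk: "p \<in> A" "k \<in> charge_class n 0" "p' \<in> A" "k' \<in> charge_class n 0"
      and eq: "to (p, k) = to (p', k')"
    have pp: "p = p'" using perm_to[OF pk(1), of k] perm_to[OF pk(3), of k'] eq
      by (auto simp: to_def intro: perm_congruent_unique)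
    have "k i = k' i" for i
    proof (cases "i \<le> n")
      case True
      have "to (p, k) i = to (p', k') i" using eq by simp
      then have "real_of_int (k i) * real (n + 1) = of_int (k' i) * real (n + 1)"
        using True pp by (simp add: to_def shift_by_def)
      then show ?thesis by (simp del: of_nat_add of_nat_Suc)
    next
      case False
      then have "i \<notin> {0..n}" by simp
      moreover have "k \<in> {0..n} \<rightarrow>\<^sub>E UNIV" "k' \<in> {0..n} \<rightarrow>\<^sub>E UNIV" using pk by (simp_all add: charge_class_def)
      ultimately have "k i = undefined" "k' i = undefined" by (blast intro: PiE_arb)+
      then show ?thesis by simp
    qed
    then show "p = p' \<and> k = k'" using pp by auto
  qed
  moreover have "to ` (A \<times> charge_class n 0) = {x \<in> index_vectors n. \<exists>p. perm_congruent n x p}"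
  proof (intro equalityI subsetI)
    fix x assume "x \<in> to ` (A \<times> charge_class n 0)"
    then obtain p k where pk: "p \<in> A" "k \<in> charge_class n 0" and x: "x = shift_by n k (weyl_vector n \<circ> p)"
      by (auto simp: to_def)
    have "perm_congruent n x p" using perm_to[OF pk(1)] x by simp
    moreover have "x \<in> index_vectors n"
    proof (rule index_vectorsI)
      have w: "weyl_vector n \<circ> p \<in> index_vectors n"
        using pk(1) by (intro index_vectors_permute weyl_vector_in) (simp add: A_def)
      show "x i = undefined" if "n < i" for i using that by (simp add: x shift_by_def)
      show "\<exists>m::int. x i = real n / 2 + of_int m" if i: "i \<le> n" for i
      proof -
        obtain m :: int where "(weyl_vector n \<circ> p) i = real n / 2 + of_int m"
          using index_vectorsD(1)[OF w i] by blast
        then have "x i = real n / 2 + of_int (m + k i * int (n + 1))"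
          using i by (simp add: x shift_by_def)
        then show ?thesis by blast
      qed
      have "(\<Sum>i=0..n. x i) = (\<Sum>i=0..n. (weyl_vector n \<circ> p) i) + real (n + 1) * of_int (\<Sum>i=0..n. k i)"
        by (simp add: x shift_by_def sum.distrib sum_distrib_left mult.commute)
      then show "(\<Sum>i=0..n. x i) = 0"
        using index_vectorsD(3)[OF w] pk(2) by (simp add: charge_class_def del: of_int_sum)
    qed
    ultimately show "x \<in> {x \<in> index_vectors n. \<exists>p. perm_congruent n x p}" by blast
  next
    fix x assume "x \<in> {x \<in> index_vectors n. \<exists>p. perm_congruent n x p}"
    then obtain p where x: "x \<in> index_vectors n" and p: "perm_congruent n x p" by blast
    obtain k where k: "(\<Sum>i=0..n. k i) = 0" "x = shift_by n k (weyl_vector n \<circ> p)" "k \<in> {0..n} \<rightarrow>\<^sub>E UNIV"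
      using perm_congruent_decompose[OF x p] by blast
    then have "x = to (p, k)" "(p, k) \<in> A \<times> charge_class n 0"
      using p by (simp_all add: to_def A_def charge_class_def perm_congruent_def)
    then show "x \<in> to ` (A \<times> charge_class n 0)" by blast
  qed
  ultimately have bij: "bij_betw to (A \<times> charge_class n 0) {x \<in> index_vectors n. \<exists>p. perm_congruent n x p}"
    by (simp add: bij_betw_def)
  have "(macdonald_term n \<tau> node has_sum S) (index_vectors n)"
    unfolding S_def by (rule has_sum_infsum[OF macdonald_term_summable])
  also have "?this \<longleftrightarrow> (macdonald_term n \<tau> node has_sum S) {x \<in> index_vectors n. \<exists>p. perm_congruent n x p}"
    by (rule has_sum_cong_neutral) (auto simp: macdonald_term_def vector_sign_def)
  also have "\<dots> \<longleftrightarrow> ((\<lambda>y. macdonald_term n \<tau> node (to y)) has_sum S) (A \<times> charge_class n 0)"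
    by (rule has_sum_reindex_bij_betw[OF bij, symmetric])
  finally have sum1: "((\<lambda>y. macdonald_term n \<tau> node (to y)) has_sum S) (A \<times> charge_class n 0)" .
  have "((\<lambda>p. phase * (of_int (sign p) * (\<Prod>i<Suc n. (omega ^ i) ^ p i)) * G) has_sum S) A"
  proof (rule has_sum_SigmaD[OF sum1])
    fix p assume "p \<in> A"
    then have p: "p permutes {0..n}" by (simp add: A_def)
    have "((\<lambda>k. phase * (of_int (sign p) * (\<Prod>i<Suc n. (omega ^ i) ^ p i)) * lattice_term n \<tau> (k \<circ> inv p)) has_sum
       phase * (of_int (sign p) * (\<Prod>i<Suc n. (omega ^ i) ^ p i)) * G) (charge_class n 0)"
      unfolding G_def by (intro has_sum_cmult_right infsum_lattice_term_permute p)
    then show "((\<lambda>k. macdonald_term n \<tau> node (to (p, k))) has_sum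
       phase * (of_int (sign p) * (\<Prod>i<Suc n. (omega ^ i) ^ p i)) * G) (charge_class n 0)"
      by (rule has_sum_cong[THEN iffD1, rotated]) (simp add: to_def macdonald_term_at_nodes[OF p] del: prod.lessThan_Suc)
  qed
  then have "S = (\<Sum>p\<in>A. phase * (of_int (sign p) * (\<Prod>i<Suc n. (omega ^ i) ^ p i)) * G)"
    by (subst (asm) has_sum_finite_iff) (simp_all add: A_def finite_permutations)
  also have "\<dots> = phase * (\<Sum>p\<in>A. of_int (sign p) * (\<Prod>i<Suc n. (omega ^ i) ^ p i)) * G"
    by (simp only: sum_distrib_left sum_distrib_right)
  also have "A = {p. p permutes {..<Suc n}}" by (simp add: A_def atLeast0AtMost lessThan_Suc_atMost)
  also have "(\<Sum>p | p permutes {..<Suc n}. of_int (sign p) * (\<Prod>i<Suc n. (omega ^ i) ^ p i)) = vandermonde_det"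
    unfolding vandermonde_det_def by (rule vandermonde_determinant[OF omega(1)])
  finally show ?thesis by (simp add: S_def G_def)
qed

theorem macdonald_const_eq: "macdonald_const n \<tau> = (- 1) ^ (n * (n + 1) div 2) * dedekind_eta \<tau> ^ (n * (n - 1) div 2)"
proof -
  define C where "C = macdonald_const n \<tau>"
  define G where "G = infsum (lattice_term n \<tau>) (charge_class n 0)"
  define \<phi> where "\<phi> = euler_phi \<tau>"
  define \<Phi> where "\<Phi> = euler_phi (of_nat (n + 1) * \<tau>)"
  define e where "e = cpow \<tau> (energy n (weyl_vector n))"
  define P where "P = n * (n + 1) div 2"
  define m where "m = n * (n - 1) div 2"
  have \<phi>: "\<phi> \<noteq> 0" using euler_phi_nonzero[OF Im_tau] by (simp add: \<phi>_def)
  have "Im (of_nat (n + 1) * \<tau>) > 0" using Im_tau by simp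
  then have \<Phi>: "\<Phi> \<noteq> 0" unfolding \<Phi>_def by (rule euler_phi_nonzero)
  have e: "e \<noteq> 0" by (simp add: e_def)
  have G: "G = e * \<Phi> ^ (n + 1) / \<phi>"
    using infsum_charge_class_0[OF Im_tau, of n] \<phi> by (simp add: G_def \<phi>_def \<Phi>_def e_def field_simps)
  have Pm: "P = m + n"
  proof -
    have "n * (n + 1) = n * (n - 1) + 2 * n" by (cases n) (simp_all add: algebra_simps)
    then show ?thesis by (simp add: P_def m_def)
  qed
  have "2 * m = n * (n - 1)" unfolding m_def by (rule dvd_mult_div_cancel) auto
  then have rm: "real m = real n * (real n - 1) / 2"
    by (cases n) (simp_all add: field_simps flip: of_nat_mult of_nat_add)
  have "C * (phase * vandermonde_det * G) = (\<Prod>(i, j)\<in>pairs n. jacobi_theta \<tau> (node i - node j))"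
    using theta_product_eq_macdonald_const[OF Im_tau, of n node]
    by (simp add: has_sum_iff infsum_cmult_right' infsum_macdonald_term_at_nodes C_def G_def)
  also have "\<dots> = phase * vandermonde_det * ((- 1) ^ P * (cpow \<tau> (1/8) * \<phi>) ^ P * (\<Phi> / \<phi>) ^ (n + 1))"
    unfolding theta_product_at_nodes card_pairs P_def \<phi>_def \<Phi>_def by (simp only: mult_ac)
  finally have "phase * vandermonde_det * (C * G) = phase * vandermonde_det * ((- 1) ^ P * (cpow \<tau> (1/8) * \<phi>) ^ P * (\<Phi> / \<phi>) ^ (n + 1))"
    by (simp only: mult_ac)
  moreover have "phase * vandermonde_det \<noteq> 0" using phase_nonzero vandermonde_det_nonzero by simp
  ultimately have "C * G = (- 1) ^ P * (cpow \<tau> (1/8) * \<phi>) ^ P * (\<Phi> / \<phi>) ^ (n + 1)"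
    using mult_left_cancel by blast
  \<comment> \<open>The exponent of \<phi> is P from the theta factors, less n + 1 from the omitted
    diagonals, plus 1 from the denominator of \<open>G\<close>: in all P - n = m. The powers of
    \<Phi> cancel.\<close>
  then have "C * e = (- 1) ^ P * cpow \<tau> (1/8) ^ P * \<phi> ^ m"
    using \<phi> \<Phi> unfolding G Pm by (simp add: power_mult_distrib power_divide power_add field_simps)
  also have "cpow \<tau> (1/8) ^ P = cpow \<tau> (1/24) ^ m * e"
  proof -
    \<comment> \<open>The arithmetic behind the 24 of eta: n (n + 1)/16 = n (n - 1)/48 + n (n +
      2)/24.\<close>
    have "real P * (1/8) = real m * (1/24) + energy n (weyl_vector n)"
      unfolding Pm energy_weyl_vector of_nat_add rm by (simp add: field_simps)
    then show ?thesis unfolding e_def cpow_power by (simp only: cpow_add)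
  qed
  finally have "C = (- 1) ^ P * (cpow \<tau> (1/24) * \<phi>) ^ m"
    using e by (simp add: power_mult_distrib)
  then show ?thesis by (simp add: C_def P_def m_def dedekind_eta_eq \<phi>_def)
qed

end

theorem theorem8p2:
  fixes n :: nat and a :: "nat \<Rightarrow> int" and \<tau> z :: complex
  assumes "n \<ge> 2"
    and "inj_on a {0..n}"
    and "Im \<tau> > 0"
  shows "theta_block_term n a \<tau> z summable_on index_vectors n \<and>
         theta_block n a \<tau> z =
           (-1) ^ (n * (n + 1) div 2) * (\<Sum>\<^sub>\<infinity>x\<in>index_vectors n. theta_block_term n a \<tau> z x)"
proof -
  interpret equally_spaced n \<tau> by unfold_locales fact
  \<comment> \<open>The theta factors see only the differences u_i - u_j = (a_i - a_j) z.\<close>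
  define u where "u i = of_int (a i) * z" for i
  define m where "m = n * (n - 1) div 2"
  have cpow_u: "cpow (u i) s = cpow z (of_int (a i) * s)" for i s
    using cpow_mult_of_real[of "of_int (a i)" z s] by (simp add: u_def)
  have T: "theta_block_term n a \<tau> z = macdonald_term n \<tau> u"
    by (simp add: fun_eq_iff theta_block_term_def macdonald_term_def energy_def cpow_u cpow_sum)
  have "(\<Prod>(i, j)\<in>{(i, j). i < j \<and> j \<le> n}. jacobi_theta_scaled (a i - a j) \<tau> z) =
      (\<Prod>(i, j)\<in>pairs n. jacobi_theta \<tau> (u i - u j))"
    by (simp add: pairs_def jacobi_theta_scaled_def u_def left_diff_distrib)
  also have "\<dots> = macdonald_const n \<tau> * infsum (macdonald_term n \<tau> u) (index_vectors n)"
    using theta_product_eq_macdonald_const[OF Im_tau, of n u] by (simp add: has_sum_iff infsum_cmult_right')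
  finally have "theta_block n a \<tau> z = dedekind_eta \<tau> powi (- int m) *
      ((- 1) ^ (n * (n + 1) div 2) * dedekind_eta \<tau> ^ m * infsum (macdonald_term n \<tau> u) (index_vectors n))"
    unfolding theta_block_def macdonald_const_eq m_def by simp
  also have "dedekind_eta \<tau> powi (- int m) * ((- 1) ^ (n * (n + 1) div 2) * dedekind_eta \<tau> ^ m * infsum (macdonald_term n \<tau> u) (index_vectors n))
      = (- 1) ^ (n * (n + 1) div 2) * infsum (macdonald_term n \<tau> u) (index_vectors n)"
    using dedekind_eta_nonzero[OF Im_tau] by (simp add: power_int_minus)
  finally show ?thesis unfolding T using macdonald_term_summable by simp
qed

end
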